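(* Let $f_1,\dots,f_n:\mathbb{R}^p\to\mathbb{R}$ be differentiable functions such that, for every $i$ and all $x,y\in\mathbb{R}^p$, $$\|\nabla f_i(x)-\nabla f_i(y)\|\le L_i\|x-y\|,\qquad f_i(x)\ge f_i(y)+\langle\nabla f_i(y),x-y\rangle+\tfrac{\mu_i}{2}\|x-y\|^2,$$ with $L_i\in(0,\infty)$, $\mu_i\in[0,\infty)$, and at least one $\mu_i>0$. Put $L=\max_iL_i$, $\bar\mu=\frac1n\sum_{i=1}^n\mu_i$, $\bar\kappa=L/\bar\mu$, and let $x^*$ be the unique minimizer of $f=\frac1n\sum_{i=1}^nf_i$ and $\mathbf{x}^*=\mathbf{1}(x^* )^\top$. Let $\mathcal{E}(0),\mathcal{E}(1),\dots$ be the edge sets of a sequence of undirected graphs on $\{1,\dots,n\}$ for which there is a positive integer $\tilde B$ such that, for every $t=0,1,\dots$, the graph with edge set $\bigcup_{\ell=t\tilde B}^{(t+1)\tilde B-1}\mathcal{E}(\ell)$ is connected; put $B=2\tilde B-1$. Let $\mathbf{W}(k)=[W_{ij}(k)]\in\mathbb{R}^{n\times n}$, $k=0,1,\dots$, satisfy: (i) $\mathbf{W}(k)\mathbf{1}=\mathbf{1}$ and $\mathbf{1}^\top\mathbf{W}(k)=\mathbf{1}^\top$; (ii) $W_{ii}(k)>0$ for all $i$; (iii) for $i\neq j$, $W_{ij}(k)>0$ if $(j,i)\in\mathcal{E}(k)$ and $W_{ij}(k)=0$ otherwise; (iv) the positive entries of all the matrices $\mathbf{W}(k)$, $k\ge 0$,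 are bounded below by a positive constant. Let $\tau>0$ be the smallest positive entry (the infimum of the positive entries) of the matrices $\mathbf{W}(k)$ over all $k$. If the step-size is $$\alpha(\tau)=\frac{3\tau^2}{128B^2n^{4.5}L\sqrt{\bar\kappa}}-\frac{1.5}{\bar\mu}\left(\frac{\tau^2}{128B^2n^{4.5}\bar\kappa^{1.5}}\right)^2,$$ then, for any $\mathbf{x}(0)\in\mathbb{R}^{n\times p}$, the sequence $\{\mathbf{x}(k)\}$ generated by the DIGing algorithm converges to $\mathbf{x}^*$ at the global R-linear (geometric) rate $O\left((\lambda(\tau))^k\right)$, i.e. there is a constant $C$ with $\|\mathbf{x}(k)-\mathbf{x}^*\|_F\le C(\lambda(\tau))^k$ for all $k\ge0$, where $$\lambda(\tau)=\sqrt[B]{1-\frac{\tau^2}{128B^2n^{4.5}\bar\kappa^{1.5}}}.$$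
   Context: $\mathbf{1}$ is the all-ones column vector in $\mathbb{R}^n$, $\|\cdot\|_F$ the Frobenius norm (Euclidean norm $\|\cdot\|$ on vectors). For $\mathbf{x}\in\mathbb{R}^{n\times p}$ with rows $x_1^\top,\dots,x_n^\top$, $\nabla\mathbf{f}(\mathbf{x})\in\mathbb{R}^{n\times p}$ denotes the matrix whose $i$-th row is $(\nabla f_i(x_i))^\top$. DIGing algorithm: with step-size $\alpha>0$, arbitrary $\mathbf{x}(0)\in\mathbb{R}^{n\times p}$ and $\mathbf{y}(0)=\nabla\mathbf{f}(\mathbf{x}(0))$, for $k=0,1,\dots$ $$\mathbf{x}(k+1)=\mathbf{W}(k)\mathbf{x}(k)-\alpha\mathbf{y}(k),\qquad \mathbf{y}(k+1)=\mathbf{W}(k)\mathbf{y}(k)+\nabla\mathbf{f}(\mathbf{x}(k+1))-\nabla\mathbf{f}(\mathbf{x}(k)).$$ *)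

theory Defs
  imports "HOL-Analysis.Analysis"
begin

definition gradient :: "('a::real_inner \<Rightarrow> real) \<Rightarrow> 'a \<Rightarrow> 'a" where
  "gradient f x = (THE D. GDERIV f x :> D)"

lemma GDERIV_gradient:
  fixes f :: "'a::euclidean_space \<Rightarrow> real"
  assumes "f differentiable (at x)"
  shows "GDERIV f x :> gradient f x"
proof -
  obtain f' where f': "(f has_derivative f') (at x)"
    using assms by (auto simp: differentiable_def)
  then have lin: "linear f'"
    using has_derivative_bounded_linear bounded_linear.linear by blast
  have "f' = (\<lambda>h. h \<bullet> adjoint f' 1)"
    using adjoint_works[OF lin, of _ "1::real"] by (auto simp: fun_eq_iff)
  with f' have ex: "GDERIV f x :> adjoint f' 1"
    by (simp add: gderiv_def)
  have "D = D'" if "GDERIV f x :> D" "GDERIV f x :> D'" for D D'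
  proof -
    have "(\<lambda>h. h \<bullet> D) = (\<lambda>h. h \<bullet> D')"
      using has_derivative_unique[OF that[unfolded gderiv_def]] .
    then show ?thesis
      by (auto simp: fun_eq_iff intro: vector_eq_ldot[THEN iffD1])
  qed
  then show ?thesis
    unfolding gradient_def using theI[of "\<lambda>D. GDERIV f x :> D", OF ex] ex by blast
qed

text \<open>A matrix in \<open>real ^ 'p ^ 'n\<close> has \<open>CARD('n)\<close> rows and \<open>CARD('p)\<close> columns. The library norm
  on this type is the Frobenius norm.\<close>

lemma norm_matrix_eq_frobenius:
  fixes M :: "real ^ 'p ^ 'n"
  shows "norm M = sqrt (\<Sum>i\<in>UNIV. \<Sum>j\<in>UNIV. (M $ i $ j)\<^sup>2)"
  by (simp add: norm_vec_def L2_set_def sum_nonneg)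

definition stacked_gradient ::
  "('n::finite \<Rightarrow> real ^ 'p \<Rightarrow> real) \<Rightarrow> real ^ 'p ^ 'n \<Rightarrow> real ^ 'p ^ 'n" where
  "stacked_gradient f x = (\<chi> i. gradient (f i) (x $ i))"

definition DIGing ::
  "('n::finite \<Rightarrow> real ^ 'p \<Rightarrow> real) \<Rightarrow> (nat \<Rightarrow> real ^ 'n ^ 'n) \<Rightarrow> real
    \<Rightarrow> (nat \<Rightarrow> real ^ 'p ^ 'n) \<Rightarrow> (nat \<Rightarrow> real ^ 'p ^ 'n) \<Rightarrow> bool" where
  "DIGing f W \<alpha> x y \<longleftrightarrow>
     y 0 = stacked_gradient f (x 0) \<and>
     (\<forall>k. x (Suc k) = W k ** x k - \<alpha> *\<^sub>R y k) \<and>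
     (\<forall>k. y (Suc k) = W k ** y k + stacked_gradient f (x (Suc k)) - stacked_gradient f (x k))"

text \<open>An undirected graph on the vertex set \<open>UNIV :: 'n set\<close> is given by its symmetric set of
  ordered pairs of adjacent vertices; loops affect nothing below and are not excluded.\<close>

definition connected_graph :: "('n \<times> 'n) set \<Rightarrow> bool" where
  "connected_graph E \<longleftrightarrow> (\<forall>i j. (i, j) \<in> E\<^sup>*)"

text \<open>The literal \<open>1 :: real ^ 'n\<close> is the all-ones vector.\<close>

definition mixing_matrix :: "('n \<times> 'n) set \<Rightarrow> real ^ 'n ^ 'n \<Rightarrow> bool" where
  "mixing_matrix E W \<longleftrightarrow>
     W *v 1 = 1 \<and> 1 v* W = 1 \<and>
     (\<forall>i. W $ i $ i > 0) \<and>
     (\<forall>i j. i \<noteq> j \<longrightarrow> (if (j, i) \<in> E then W $ i $ j > 0 else W $ i $ j = 0))"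

definition positive_entries :: "(nat \<Rightarrow> real ^ 'n ^ 'n) \<Rightarrow> real set" where
  "positive_entries W = {W k $ i $ j | k i j. W k $ i $ j > 0}"

end

(*
  With D = tau^2 / (128 B^2 n^4.5 kappa^1.5) the step size satisfies alpha mubar = 1.5 (2 D - D^2)
  and lam^B = 1 - D. One follows three errors: the deviations a = |x - 1 xbar^T| and
  b = |y - 1 ybar^T| from the row averages, and c = sqrt n |xbar - xstar|.

  Consensus. Over a window of B steps, which contains a full block of Bt steps, the mixing matrices
  contract vectors of mean zero by 1 - tau / (4 n^2): sort the entries at the start of a block and
  consider the first time at which an edge crosses each gap between consecutive values. Until then
  the two sides of the gap do not mix, and at that time the drop of the squared norm,
  sum_ij W_ij (u_j - (W u)_i)^2, pays for the squared lengths of all gaps being crossed.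

  Coupling. The row average performs gradient steps on f, perturbed by alpha L a, and y is perturbed
  by the gradient increments, which are at most L |x(k+1) - x(k)|; bounding the increment of x by
  2 a + alpha b + alpha L (a + c), rather than by the distance of x to the optimum, makes the
  constants of the theorem suffice. Suitable multiples of lam^k then bound a, b and c inductively.
*)
theory Submission
  imports Defs
begin

subsection \<open>Contraction over jointly connected graphs\<close>

lemma mixing_matrixD:
  fixes W :: "real ^ 'n ^ 'n"
  assumes "mixing_matrix E W"
  shows mixing_matrix_nonneg: "W $ i $ j \<ge> 0"
    and mixing_matrix_row_sum: "(\<Sum>j\<in>UNIV. W $ i $ j) = 1"
    and mixing_matrix_col_sum: "(\<Sum>i\<in>UNIV. W $ i $ j) = 1"
proof -
  show "W $ i $ j \<ge> 0"
    using assms unfolding mixing_matrix_def by (metis less_eq_real_def order_refl)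
  have "(W *v 1) $ i = 1" "(1 v* W) $ j = 1"
    using assms by (simp_all add: mixing_matrix_def)
  then show "(\<Sum>j\<in>UNIV. W $ i $ j) = 1" "(\<Sum>i\<in>UNIV. W $ i $ j) = 1"
    by (simp_all add: matrix_vector_mult_def vector_matrix_mult_def)
qed

lemma norm_vec_squared: "(norm (u :: real ^ 'n))\<^sup>2 = (\<Sum>i\<in>UNIV. (u $ i)\<^sup>2)"
  by (simp add: norm_vec_def L2_set_def sum_nonneg)

text \<open>Variance identity: each row of \<open>W\<close> has total weight one and mean
  \<open>(W *v u) $ i\<close>, so its weighted spread is second moment minus squared mean. Summing
  the second moments over all rows and using the column sums returns the squared norm of
  \<open>u\<close>.\<close>

lemma norm_squared_decrease:
  fixes W :: "real ^ 'n ^ 'n" and u :: "real ^ 'n"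
  assumes row: "\<And>i. (\<Sum>j\<in>UNIV. W $ i $ j) = 1" and col: "\<And>j. (\<Sum>i\<in>UNIV. W $ i $ j) = 1"
  shows "(norm u)\<^sup>2 - (norm (W *v u))\<^sup>2
    = (\<Sum>i\<in>UNIV. \<Sum>j\<in>UNIV. W $ i $ j * (u $ j - (W *v u) $ i)\<^sup>2)"
proof -
  define v where "v = W *v u"
  have v: "(\<Sum>j\<in>UNIV. W $ i $ j * u $ j) = v $ i" for i
    by (simp add: v_def matrix_vector_mult_def)
  have "(\<Sum>j\<in>UNIV. W $ i $ j * (u $ j - v $ i)\<^sup>2)
      = (\<Sum>j\<in>UNIV. W $ i $ j * (u $ j)\<^sup>2) - (v $ i)\<^sup>2" for i
  proof -
    have "(\<Sum>j\<in>UNIV. W $ i $ j * (u $ j - v $ i)\<^sup>2)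
        = (\<Sum>j\<in>UNIV. W $ i $ j * (u $ j)\<^sup>2 - 2 * v $ i * (W $ i $ j * u $ j) + (v $ i)\<^sup>2 * W $ i $ j)"
      by (simp add: power2_eq_square algebra_simps)
    also have "\<dots> = (\<Sum>j\<in>UNIV. W $ i $ j * (u $ j)\<^sup>2) - 2 * v $ i * v $ i + (v $ i)\<^sup>2"
      by (simp add: sum.distrib sum_subtractf sum_distrib_left[symmetric] v row)
    finally show ?thesis by (simp add: power2_eq_square)
  qed
  then have "(\<Sum>i\<in>UNIV. \<Sum>j\<in>UNIV. W $ i $ j * (u $ j - v $ i)\<^sup>2)
      = (\<Sum>i\<in>UNIV. \<Sum>j\<in>UNIV. W $ i $ j * (u $ j)\<^sup>2) - (norm v)\<^sup>2"
    by (simp add: sum_subtractf norm_vec_squared)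
  also have "(\<Sum>i\<in>UNIV. \<Sum>j\<in>UNIV. W $ i $ j * (u $ j)\<^sup>2) = (norm u)\<^sup>2"
    by (subst sum.swap) (simp add: sum_distrib_right[symmetric] col norm_vec_squared)
  finally show ?thesis by (simp add: v_def)
qed

text \<open>All gaps are nonnegative, so \<open>D\<close> may be enlarged to the whole interval from
  its minimum to its maximum, where the sum telescopes.\<close>

lemma sum_gaps_le:
  fixes g :: "nat \<Rightarrow> real"
  assumes "finite D" "D \<noteq> {}" "D \<subseteq> {..<N}" and mono: "\<And>d. d < N \<Longrightarrow> g d \<le> g (Suc d)"
  shows "(\<Sum>d\<in>D. g (Suc d) - g d) \<le> g (Suc (Max D)) - g (Min D)"
proof -
  have le: "Min D \<le> Max D" and lt: "Max D < N"
    using assms by (auto intro: Max_in)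
  have "(\<Sum>d\<in>D. g (Suc d) - g d) \<le> (\<Sum>d=Min D..<Suc (Max D). g (Suc d) - g d)"
    using assms(1) lt mono by (intro sum_mono2) (auto simp: less_Suc_eq_le)
  also have "\<dots> = g (Suc (Max D)) - g (Min D)"
    using le by (intro sum_Suc_diff') simp
  finally show ?thesis .
qed

lemma sum_squares_le_square_sum:
  fixes h :: "'a \<Rightarrow> real"
  assumes "finite D" "\<And>d. d \<in> D \<Longrightarrow> h d \<ge> 0"
  shows "(\<Sum>d\<in>D. (h d)\<^sup>2) \<le> (\<Sum>d\<in>D. h d)\<^sup>2"
  using assms
proof (induction D)
  case (insert d D)
  have "0 \<le> h d * (\<Sum>d\<in>D. h d)"
    using insert by (intro mult_nonneg_nonneg sum_nonneg) auto
  with insert show ?case by (simp add: power2_sum)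
qed simp

text \<open>Two points cannot both be close to \<open>c\<close>: the squared distances to
  \<open>c\<close> add up to at least half of the squared distance between them. In the application
  \<open>c\<close> is the new value of a vertex, and the two points are its own old value and that
  of a neighbour.\<close>

lemma weighted_spread_ge:
  fixes w v :: "'n::finite \<Rightarrow> real"
  assumes "\<And>j. w j \<ge> 0" and "\<tau> \<ge> 0" "w i \<ge> \<tau>" "w j \<ge> \<tau>" and "i \<noteq> j"
  shows "\<tau> / 2 * (v i - v j)\<^sup>2 \<le> (\<Sum>j\<in>UNIV. w j * (v j - c)\<^sup>2)"
proof -
  have "(v i - v j)\<^sup>2 / 2 \<le> (v i - c)\<^sup>2 + (v j - c)\<^sup>2"
    using zero_le_power2[of "(v i - c) + (v j - c)"] by (simp add: power2_eq_square field_simps)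
  from mult_left_mono[OF this \<open>\<tau> \<ge> 0\<close>]
  have "\<tau> / 2 * (v i - v j)\<^sup>2 \<le> \<tau> * (v i - c)\<^sup>2 + \<tau> * (v j - c)\<^sup>2"
    by (simp add: algebra_simps)
  also have "\<dots> \<le> w i * (v i - c)\<^sup>2 + w j * (v j - c)\<^sup>2"
    using assms by (intro add_mono mult_right_mono) auto
  also have "\<dots> = (\<Sum>j\<in>{i, j}. w j * (v j - c)\<^sup>2)"
    using \<open>i \<noteq> j\<close> by simp
  also have "\<dots> \<le> (\<Sum>j\<in>UNIV. w j * (v j - c)\<^sup>2)"
    using assms by (intro sum_mono2) auto
  finally show ?thesis .
qed

lemma connected_graph_crossing:
  assumes "connected_graph E" "i \<in> S" "j \<notin> S"
  shows "\<exists>i\<in>S. \<exists>j. j \<notin> S \<and> (i, j) \<in> E"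
proof (rule ccontr)
  assume no: "\<not> ?thesis"
  have "(i, j) \<in> E\<^sup>*" using assms by (simp add: connected_graph_def)
  then have "j \<in> S"
    by (induction rule: rtrancl_induct) (use no assms(2) in auto)
  with assms show False by simp
qed

text \<open>Without edges across the cut, a row indexed in \<open>S\<close> averages only over
  entries in \<open>S\<close>, hence over values at least \<open>c\<close>.\<close>

lemma invariant_cut_step:
  fixes W :: "real ^ 'n ^ 'n"
  assumes mix: "mixing_matrix E W"
    and no: "\<And>i j. i \<in> S \<Longrightarrow> j \<notin> S \<Longrightarrow> (j, i) \<notin> E"
    and ge: "\<And>i. i \<in> S \<Longrightarrow> u $ i \<ge> c" and i: "i \<in> S"
  shows "(W *v u) $ i \<ge> c"
proof -
  have "c = (\<Sum>j\<in>UNIV. W $ i $ j * c)"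
    by (simp add: sum_distrib_right[symmetric] mixing_matrix_row_sum[OF mix])
  also have "\<dots> \<le> (\<Sum>j\<in>UNIV. W $ i $ j * u $ j)"
  proof (rule sum_mono)
    fix j
    show "W $ i $ j * c \<le> W $ i $ j * u $ j"
    proof (cases "j \<in> S")
      case True
      then show ?thesis using ge mixing_matrix_nonneg[OF mix] by (intro mult_left_mono) auto
    next
      case False
      then have "W $ i $ j = 0" using mix no[OF i False] i unfolding mixing_matrix_def by metis
      then show ?thesis by simp
    qed
  qed
  finally show ?thesis by (simp add: matrix_vector_mult_def)
qed

text \<open>Each gap is charged to the step and the upper endpoint of its first crossing edge; this
  bounds the sum of the squared gaps by \<open>2 / \<tau>\<close> times the total drop of the
  squared norm. For mean zero every entry is at most the sum of the gaps in absolute value, so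
  Cauchy-Schwarz bounds the initial squared norm by \<open>CARD('n)\<close> squared times the sum of
  the squared gaps.\<close>

lemma consensus_contraction:
  fixes W :: "nat \<Rightarrow> real ^ 'n ^ 'n" and u :: "nat \<Rightarrow> real ^ 'n"
  assumes mix: "\<And>l. l < T \<Longrightarrow> mixing_matrix (E l) (W l)"
    and sym: "\<And>l. l < T \<Longrightarrow> sym (E l)"
    and conn: "connected_graph (\<Union>l<T. E l)"
    and tau: "\<tau> > 0" "\<And>l i j. l < T \<Longrightarrow> W l $ i $ j > 0 \<Longrightarrow> \<tau> \<le> W l $ i $ j"
    and step: "\<And>l. l < T \<Longrightarrow> u (Suc l) = W l *v u l"
    and zero: "(\<Sum>i\<in>UNIV. u 0 $ i) = 0"
  shows "(norm (u T))\<^sup>2 \<le> (1 - \<tau> / (2 * (real CARD('n))\<^sup>2)) * (norm (u 0))\<^sup>2"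
proof -
  \<comment> \<open>\<open>vs\<close> lists the distinct initial values in increasing order, so
    there are \<open>N\<close> gaps, and \<open>S d\<close> consists of the vertices starting above
    gap \<open>d\<close>.\<close>
  define vs where "vs = sorted_list_of_set (range (\<lambda>i. u 0 $ i))"
  define g where "g = (!) vs"
  define N where "N = length vs - 1"
  define S where "S d = {i. u 0 $ i \<ge> g (Suc d)}" for d
  have set_vs: "set vs = range (\<lambda>i. u 0 $ i)" by (simp add: vs_def)
  have len: "length vs = Suc N"
  proof -
    have "vs \<noteq> []" using set_vs by auto
    then show ?thesis by (simp add: N_def)
  qed
  have N_le: "N \<le> CARD('n)"
  proof -
    have "length vs \<le> CARD('n)" by (simp add: vs_def card_image_le)
    then show ?thesis using len by simp
  qed
  have g_less: "g d < g e" if "d < e" "e \<le> N" for d e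
    using that len sorted_wrt_nth_less[of "(<)" vs d e] by (simp add: g_def vs_def)
  have g_le: "g d \<le> g e" if "d \<le> e" "e \<le> N" for d e
    using that g_less[of d e] by (cases "d = e") auto
  have val: "\<exists>m\<le>N. u 0 $ i = g m" for i
  proof -
    have "u 0 $ i \<in> set vs" by (simp add: set_vs)
    then show ?thesis using len by (auto simp: in_set_conv_nth g_def less_Suc_eq_le)
  qed
  have val': "\<exists>i. u 0 $ i = g m" if "m \<le> N" for m
  proof -
    have "g m \<in> set vs" using that len by (simp add: g_def)
    then show ?thesis unfolding set_vs by auto
  qed
  have notS: "u 0 $ i \<le> g d" if d: "d < N" and "i \<notin> S d" for d i
  proof -
    obtain m where m: "m \<le> N" "u 0 $ i = g m" using val by blast
    have "m \<le> d"
    proof (rule ccontr)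
      assume "\<not> m \<le> d"
      then show False using g_le[of "Suc d" m] m that by (auto simp: S_def)
    qed
    then show ?thesis using g_le[of m d] d m by simp
  qed
  define cross where "cross d l \<longleftrightarrow> l < T \<and> (\<exists>i\<in>S d. \<exists>j. j \<notin> S d \<and> (i, j) \<in> E l)" for d l
  have ex_cross: "\<exists>l. cross d l" if d: "d < N" for d
  proof -
    obtain i j where "u 0 $ i = g (Suc d)" "u 0 $ j = g d"
      using val'[of d] val'[of "Suc d"] d by auto
    then have "i \<in> S d" "j \<notin> S d" using g_less[of d "Suc d"] d by (auto simp: S_def)
    from connected_graph_crossing[OF conn this] show ?thesis by (auto simp: cross_def)
  qed
  define t where "t d = (LEAST l. cross d l)" for d
  have cross_t: "cross d (t d)" if "d < N" for d
    using ex_cross[OF that] unfolding t_def by (rule LeastI_ex)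
  have not_cross: "\<not> cross d l" if "l < t d" for d l
    using that not_less_Least unfolding t_def by blast
  \<comment> \<open>The time \<open>t d\<close> itself is included: the values at that time result
    only from earlier steps, none of which crosses the gap.\<close>
  have inv: "(\<forall>i\<in>S d. u l $ i \<ge> g (Suc d)) \<and> (\<forall>i. i \<notin> S d \<longrightarrow> u l $ i \<le> g d)"
    if d: "d < N" and "l \<le> t d" for d l
    using that(2)
  proof (induction l)
    case 0
    then show ?case using notS[OF d] by (auto simp: S_def)
  next
    case (Suc l)
    then have l: "l < t d" "l < T" using cross_t[OF d] by (auto simp: cross_def)
    have no: "(j, i) \<notin> E l" "(i, j) \<notin> E l" if "i \<in> S d" "j \<notin> S d" for i j
      using not_cross[OF l(1)] l(2) that symD[OF sym[OF l(2)]] by (auto simp: cross_def)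
    have IH: "\<forall>i\<in>S d. u l $ i \<ge> g (Suc d)" "\<forall>i. i \<notin> S d \<longrightarrow> u l $ i \<le> g d"
      using Suc l by auto
    have "u (Suc l) $ i \<ge> g (Suc d)" if "i \<in> S d" for i
      unfolding step[OF l(2)]
      by (rule invariant_cut_step[OF mix[OF l(2)], where S = "S d"]) (use no IH that in auto)
    moreover have "u (Suc l) $ i \<le> g d" if "i \<notin> S d" for i
    proof -
      \<comment> \<open>The upper bound below the gap is the lower bound for the negated vector on
        the complement of \<open>S d\<close>.\<close>
      have "(W l *v (- u l)) $ i \<ge> - g d"
        by (rule invariant_cut_step[OF mix[OF l(2)], where S = "- S d"]) (use no IH that in auto)
      then show ?thesis
        by (simp add: step[OF l(2)] matrix_vector_mult_def sum_negf)
    qed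
    ultimately show ?case by blast
  qed
  have "\<forall>d. \<exists>i j. d < N \<longrightarrow> i \<in> S d \<and> j \<notin> S d \<and> (i, j) \<in> E (t d)"
    using cross_t unfolding cross_def by blast
  then obtain p q where pq: "\<And>d. d < N \<Longrightarrow> p d \<in> S d \<and> q d \<notin> S d \<and> (p d, q d) \<in> E (t d)"
    by metis
  have t_less: "t d < T" if "d < N" for d
    using cross_t[OF that] by (simp add: cross_def)
  \<comment> \<open>\<open>V l i\<close> is the contribution of row \<open>i\<close> to the drop of
    the squared norm in step \<open>l\<close>, by \<open>norm_squared_decrease\<close>.\<close>
  define V where "V l i = (\<Sum>j\<in>UNIV. W l $ i $ j * (u l $ j - u (Suc l) $ i)\<^sup>2)" for l i
  define gap where "gap d = g (Suc d) - g d" for d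
  have gap_nonneg: "gap d \<ge> 0" if "d < N" for d
    using g_le[of d "Suc d"] that by (simp add: gap_def)
  have local: "(\<Sum>d\<in>{d \<in> {..<N}. (t d, p d) = (l, i)}. (gap d)\<^sup>2) \<le> 2 / \<tau> * V l i"
    (is "sum _ ?D \<le> _") if l: "l < T" for l i
  proof (cases "?D = {}")
    case True
    have "0 \<le> V l i"
      unfolding V_def using mixing_matrix_nonneg[OF mix[OF l]] by (intro sum_nonneg) auto
    then show ?thesis unfolding True using tau(1) by simp
  next
    case False
    have fin: "finite ?D" by simp
    \<comment> \<open>All gaps charged to \<open>(l, i)\<close> lie between \<open>dm\<close> and
      \<open>dM\<close>. Vertex \<open>i\<close> is still above the highest of them and its
      neighbour \<open>q dm\<close> still below the lowest, so the difference of these two values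
      covers all the charged gaps at once.\<close>
    define dm dM where "dm = Min ?D" and "dM = Max ?D"
    have dm: "dm < N" "t dm = l" "p dm = i" and dM: "dM < N" "t dM = l" "p dM = i"
      using Min_in[OF fin False] Max_in[OF fin False] unfolding dm_def dM_def by auto
    have neq: "i \<noteq> q dm" and edge: "(q dm, i) \<in> E l"
      using pq[OF dm(1)] dm symD[OF sym[OF l]] by auto
    have W_pos: "W l $ i $ q dm > 0" "W l $ i $ i > 0"
      using mix[OF l] neq edge unfolding mixing_matrix_def by metis+
    have "(\<Sum>d\<in>?D. gap d) \<le> g (Suc dM) - g dm"
      unfolding gap_def dm_def dM_def
      by (rule sum_gaps_le[OF fin False, of N]) (auto intro: g_le)
    also have "\<dots> \<le> u l $ i - u l $ q dm"
      using inv[OF dM(1), of l] inv[OF dm(1), of l] pq[OF dM(1)] pq[OF dm(1)] dm dM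
      by (intro diff_mono) auto
    finally have "(\<Sum>d\<in>?D. gap d) \<le> u l $ i - u l $ q dm" .
    moreover have "0 \<le> (\<Sum>d\<in>?D. gap d)"
      by (intro sum_nonneg) (auto intro: gap_nonneg)
    ultimately have "(\<Sum>d\<in>?D. gap d)\<^sup>2 \<le> (u l $ i - u l $ q dm)\<^sup>2"
      by (rule power_mono)
    moreover have "(\<Sum>d\<in>?D. (gap d)\<^sup>2) \<le> (\<Sum>d\<in>?D. gap d)\<^sup>2"
      by (rule sum_squares_le_square_sum) (auto intro: gap_nonneg)
    \<comment> \<open>Row \<open>i\<close> gives weight at least \<open>\<tau>\<close> both to
      \<open>i\<close> itself, by the positive diagonal, and to \<open>q dm\<close>, by the crossing
      edge.\<close>
    moreover have "\<tau> / 2 * (u l $ i - u l $ q dm)\<^sup>2 \<le> V l i"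
      unfolding V_def
      by (rule weighted_spread_ge)
        (use tau tau(2)[OF l] W_pos neq mixing_matrix_nonneg[OF mix[OF l]] in auto)
    then have "(u l $ i - u l $ q dm)\<^sup>2 \<le> 2 / \<tau> * V l i"
      using tau(1) by (simp add: field_simps)
    ultimately show ?thesis by linarith
  qed
  have "(\<Sum>d<N. (gap d)\<^sup>2)
      = (\<Sum>li\<in>{..<T} \<times> UNIV. \<Sum>d\<in>{d \<in> {..<N}. (t d, p d) = li}. (gap d)\<^sup>2)"
    by (rule sum.group[symmetric]) (auto intro: t_less)
  also have "\<dots> \<le> (\<Sum>li\<in>{..<T} \<times> UNIV. 2 / \<tau> * (case li of (l, i) \<Rightarrow> V l i))"
    using local by (intro sum_mono) (auto simp del: prod.inject)
  also have "\<dots> = 2 / \<tau> * (\<Sum>l<T. \<Sum>i\<in>UNIV. V l i)"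
    by (simp only: sum_distrib_left[symmetric] sum.cartesian_product)
  also have "(\<Sum>l<T. \<Sum>i\<in>UNIV. V l i) = (\<Sum>l<T. (norm (u l))\<^sup>2 - (norm (u (Suc l)))\<^sup>2)"
  proof (rule sum.cong)
    fix l assume "l \<in> {..<T}"
    then have l: "l < T" by simp
    show "(\<Sum>i\<in>UNIV. V l i) = (norm (u l))\<^sup>2 - (norm (u (Suc l)))\<^sup>2"
      unfolding V_def step[OF l] using mixing_matrix_row_sum[OF mix[OF l]] mixing_matrix_col_sum[OF mix[OF l]]
      by (intro norm_squared_decrease[symmetric]) auto
  qed simp
  also have "\<dots> = (norm (u 0))\<^sup>2 - (norm (u T))\<^sup>2"
    by (rule sum_lessThan_telescope')
  finally have gaps: "(\<Sum>d<N. (gap d)\<^sup>2) \<le> 2 / \<tau> * ((norm (u 0))\<^sup>2 - (norm (u T))\<^sup>2)" .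
  define R where "R = (\<Sum>d<N. gap d)"
  have R: "R = g N - g 0" unfolding R_def gap_def by (rule sum_lessThan_telescope)
  have bounds: "g 0 \<le> u 0 $ i" "u 0 $ i \<le> g N" for i
    using val[of i] by (auto intro: g_le)
  \<comment> \<open>Mean zero places 0 between the smallest and the largest entry, so no entry
    exceeds the range \<open>R\<close> in absolute value.\<close>
  have "g 0 \<le> 0 \<and> 0 \<le> g N"
  proof -
    have "(\<Sum>i\<in>(UNIV::'n set). g 0) \<le> (\<Sum>i\<in>UNIV. u 0 $ i)" "(\<Sum>i\<in>UNIV. u 0 $ i) \<le> (\<Sum>i\<in>(UNIV::'n set). g N)"
      by (intro sum_mono bounds)+
    then show ?thesis by (simp add: zero mult_le_0_iff zero_le_mult_iff)
  qed
  then have abs_u: "\<bar>u 0 $ i\<bar> \<le> R" for i using bounds[of i] by (auto simp: R abs_le_iff)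
  have "(norm (u 0))\<^sup>2 \<le> (\<Sum>i\<in>(UNIV::'n set). R\<^sup>2)"
    unfolding norm_vec_squared using abs_u by (intro sum_mono) (metis abs_ge_zero power2_abs power_mono)
  also have "\<dots> = real CARD('n) * R\<^sup>2" by simp
  also have "R\<^sup>2 \<le> real N * (\<Sum>d<N. (gap d)\<^sup>2)"
    using sum_squared_le_sum_of_squares[of gap "{..<N}"] by (simp add: R_def mult.commute)
  also have "\<dots> \<le> real CARD('n) * (2 / \<tau> * ((norm (u 0))\<^sup>2 - (norm (u T))\<^sup>2))"
    using N_le by (intro mult_mono gaps) (auto intro: sum_nonneg)
  finally have "(norm (u 0))\<^sup>2 \<le> real CARD('n) * (real CARD('n) * (2 / \<tau> * ((norm (u 0))\<^sup>2 - (norm (u T))\<^sup>2)))"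
    by simp
  then show ?thesis using tau(1) by (simp add: field_simps power2_eq_square)
qed

subsection \<open>Row averages and deviations\<close>

definition stack_rows :: "real ^ 'p \<Rightarrow> real ^ 'p ^ 'n" where
  "stack_rows v = (\<chi> i. v)"

definition row_avg :: "real ^ 'p ^ 'n \<Rightarrow> real ^ 'p" where
  "row_avg M = (1 / real CARD('n)) *\<^sub>R (\<Sum>i\<in>UNIV. M $ i)"

text \<open>The orthogonal projection off the consensus subspace, the matrices with all rows
  equal.\<close>

definition deviation :: "real ^ 'p ^ 'n \<Rightarrow> real ^ 'p ^ 'n" where
  "deviation M = M - stack_rows (row_avg M)"

lemma stack_rows_nth [simp]: "stack_rows v $ i = v"
  by (simp add: stack_rows_def)

lemma stack_rows_add: "stack_rows (u + v) = stack_rows u + stack_rows v"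
  and stack_rows_diff: "stack_rows (u - v) = stack_rows u - stack_rows v"
  and stack_rows_scaleR: "stack_rows (r *\<^sub>R u) = r *\<^sub>R stack_rows u"
  by (simp_all add: vec_eq_iff)

lemma row_avg_add: "row_avg (M + N) = row_avg M + row_avg N"
  and row_avg_diff: "row_avg (M - N) = row_avg M - row_avg N"
  and row_avg_scaleR: "row_avg (r *\<^sub>R M) = r *\<^sub>R row_avg M"
  by (simp_all add: row_avg_def sum.distrib sum_subtractf scaleR_right_distrib
      scaleR_right_diff_distrib scaleR_sum_right mult.commute)

lemma row_avg_stack_rows [simp]: "row_avg (stack_rows v :: real ^ 'p ^ 'n) = v"
  by (simp add: row_avg_def sum_constant_scaleR del: sum_constant)

lemma row_avg_deviation [simp]: "row_avg (deviation M) = 0"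
  by (simp add: deviation_def row_avg_diff)

lemma deviation_add: "deviation (M + N) = deviation M + deviation N"
  and deviation_diff: "deviation (M - N) = deviation M - deviation N"
  and deviation_scaleR: "deviation (r *\<^sub>R M) = r *\<^sub>R deviation M"
  by (simp_all add: deviation_def row_avg_add row_avg_diff row_avg_scaleR
      stack_rows_add stack_rows_diff stack_rows_scaleR algebra_simps)

lemma norm_stack_rows: "norm (stack_rows v :: real ^ 'p ^ 'n) = sqrt (real CARD('n)) * norm v"
  by (simp add: norm_vec_def L2_set_def real_sqrt_mult sum_nonneg)

text \<open>The rows of the deviation sum to zero, so it is orthogonal to every matrix with equal
  rows, and Pythagoras applies.\<close>

lemma norm_squared_deviation:
  fixes M :: "real ^ 'p ^ 'n"
  shows "(norm M)\<^sup>2 = (norm (deviation M))\<^sup>2 + (norm (stack_rows (row_avg M) :: real ^ 'p ^ 'n))\<^sup>2"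
proof -
  have sum: "(\<Sum>i\<in>UNIV. M $ i) = real CARD('n) *\<^sub>R row_avg M"
    by (simp add: row_avg_def)
  have "deviation M \<bullet> stack_rows (row_avg M) = (\<Sum>i\<in>UNIV. M $ i - row_avg M) \<bullet> row_avg M"
    by (simp add: inner_vec_def[where 'b = 'n] deviation_def inner_sum_left)
  also have "\<dots> = 0" by (simp add: sum_subtractf sum sum_constant_scaleR del: sum_constant)
  finally have "deviation M \<bullet> stack_rows (row_avg M) = 0" .
  moreover have "M = deviation M + stack_rows (row_avg M)" by (simp add: deviation_def)
  ultimately show ?thesis
    by (metis norm_add_Pythagorean orthogonal_def)
qed

lemma norm_deviation_le: "norm (deviation M) \<le> norm M"
  and norm_stack_rows_row_avg_le: "norm (stack_rows (row_avg M) :: real ^ 'p ^ 'n) \<le> norm M"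
  for M :: "real ^ 'p ^ 'n"
  using norm_squared_deviation[of M] by (auto intro: power2_le_imp_le)

lemma row_avg_mixing:
  assumes "mixing_matrix E W"
  shows "row_avg (W ** M) = row_avg M"
proof -
  have "(\<Sum>i\<in>UNIV. (W ** M) $ i $ j) = (\<Sum>i\<in>UNIV. M $ i $ j)" for j
    unfolding matrix_matrix_mult_def
    by (simp, subst sum.swap)
      (simp add: sum_distrib_right[symmetric] mixing_matrix_col_sum[OF assms])
  then show ?thesis by (simp add: row_avg_def vec_eq_iff)
qed

lemma mixing_stack_rows:
  assumes "mixing_matrix E W"
  shows "W ** stack_rows v = stack_rows v"
  by (simp add: vec_eq_iff matrix_matrix_mult_def sum_distrib_right[symmetric]
      mixing_matrix_row_sum[OF assms])

lemma matrix_mult_diff_right: "W ** (M - N) = W ** M - W ** N"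
  for W :: "real ^ 'n ^ 'm"
  by (simp add: vec_eq_iff matrix_matrix_mult_def right_diff_distrib sum_subtractf)

lemma deviation_mixing:
  assumes "mixing_matrix E W"
  shows "deviation (W ** M) = W ** deviation M"
  by (simp add: deviation_def matrix_mult_diff_right row_avg_mixing[OF assms] mixing_stack_rows[OF assms])

lemma norm_squared_columns: "(norm M)\<^sup>2 = (\<Sum>j\<in>UNIV. (norm (column j M))\<^sup>2)"
  for M :: "real ^ 'p ^ 'n"
  unfolding norm_matrix_eq_frobenius norm_vec_squared
  by (subst sum.swap) (simp add: sum_nonneg column_def)

lemma column_matrix_mult: "column j (W ** M) = W *v column j M"
  for W :: "real ^ 'n ^ 'm"
  by (simp add: vec_eq_iff matrix_matrix_mult_def matrix_vector_mult_def column_def)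

text \<open>By \<open>norm_squared_decrease\<close> the loss of squared norm in each column is a sum
  of nonnegative terms.\<close>

lemma norm_mixing_le:
  assumes "mixing_matrix E W"
  shows "norm (W ** M) \<le> norm M"
proof -
  have "(norm (W *v u))\<^sup>2 \<le> (norm u)\<^sup>2" for u
  proof -
    have "0 \<le> (norm u)\<^sup>2 - (norm (W *v u))\<^sup>2"
      using mixing_matrixD[OF assms] by (subst norm_squared_decrease) (auto intro!: sum_nonneg)
    then show ?thesis by simp
  qed
  then have "(norm (W ** M))\<^sup>2 \<le> (norm M)\<^sup>2"
    unfolding norm_squared_columns column_matrix_mult by (intro sum_mono)
  then show ?thesis by (auto intro: power2_le_imp_le)
qed

lemma one_le_CARD: "1 \<le> real CARD('n::finite)"
  using zero_less_card_finite[where 'a = 'n] by linarith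

lemma contraction_factor_nonneg:
  assumes "\<tau> \<le> 1"
  shows "0 \<le> 1 - \<tau> / (4 * (real CARD('n::finite))\<^sup>2)"
proof -
  have "\<tau> \<le> 4 * (real CARD('n))\<^sup>2"
    using assms one_le_power[OF one_le_CARD[where 'n = 'n], of 2] by linarith
  then show ?thesis by (simp add: divide_le_eq)
qed

text \<open>The vector case applies to each column. Passing from squared norms to norms uses
  \<open>1 - 2 * r \<le> (1 - r)\<^sup>2\<close>, which halves the gain and turns the 2 in the
  denominator into a 4.\<close>

lemma matrix_consensus_contraction:
  fixes W :: "nat \<Rightarrow> real ^ 'n ^ 'n" and u :: "nat \<Rightarrow> real ^ 'p ^ 'n"
  assumes mix: "\<And>l. l < T \<Longrightarrow> mixing_matrix (E l) (W l)"
    and sym: "\<And>l. l < T \<Longrightarrow> sym (E l)"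
    and conn: "connected_graph (\<Union>l<T. E l)"
    and tau: "\<tau> > 0" "\<tau> \<le> 1" "\<And>l i j. l < T \<Longrightarrow> W l $ i $ j > 0 \<Longrightarrow> \<tau> \<le> W l $ i $ j"
    and step: "\<And>l. l < T \<Longrightarrow> u (Suc l) = W l ** u l"
    and zero: "row_avg (u 0) = 0"
  shows "norm (u T) \<le> (1 - \<tau> / (4 * (real CARD('n))\<^sup>2)) * norm (u 0)"
proof -
  define r where "r = \<tau> / (4 * (real CARD('n))\<^sup>2)"
  have r: "r \<le> 1"
    using contraction_factor_nonneg[OF tau(2), where 'n = 'n] by (simp add: r_def)
  have "(\<Sum>i\<in>UNIV. column j (u 0) $ i) = 0" for j
  proof -
    have "(\<Sum>i\<in>UNIV. u 0 $ i) = 0" using zero by (simp add: row_avg_def)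
    then have "(\<Sum>i\<in>UNIV. u 0 $ i) $ j = 0" by simp
    then show ?thesis by (simp add: column_def)
  qed
  then have "(norm (column j (u T)))\<^sup>2 \<le> (1 - \<tau> / (2 * (real CARD('n))\<^sup>2)) * (norm (column j (u 0)))\<^sup>2" for j
    by (intro consensus_contraction[of T E W \<tau> "\<lambda>l. column j (u l)"] mix sym conn tau)
      (simp_all add: step column_matrix_mult)
  then have "(norm (u T))\<^sup>2 \<le> (1 - \<tau> / (2 * (real CARD('n))\<^sup>2)) * (norm (u 0))\<^sup>2"
    unfolding norm_squared_columns sum_distrib_left by (intro sum_mono)
  also have "\<dots> = (1 - 2 * r) * (norm (u 0))\<^sup>2"
    by (simp add: r_def)
  also have "\<dots> \<le> (1 - r)\<^sup>2 * (norm (u 0))\<^sup>2"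
  proof (rule mult_right_mono)
    show "1 - 2 * r \<le> (1 - r)\<^sup>2"
      by (simp add: power2_diff)
  qed (rule zero_le_power2)
  finally have "(norm (u T))\<^sup>2 \<le> ((1 - r) * norm (u 0))\<^sup>2"
    unfolding power_mult_distrib .
  then have "norm (u T) \<le> (1 - r) * norm (u 0)"
    by (rule power2_le_imp_le) (use r in simp)
  then show ?thesis by (simp add: r_def)
qed

text \<open>The orbit is compared with the unperturbed one started at the same point. Mixing does
  not increase norms, so the perturbations merely add up, while the unperturbed orbit contracts on a
  full block inside the window.\<close>

lemma perturbed_consensus_window:
  fixes W :: "nat \<Rightarrow> real ^ 'n ^ 'n" and v e :: "nat \<Rightarrow> real ^ 'p ^ 'n"
  assumes mix: "\<And>k. mixing_matrix (E k) (W k)"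
    and sym: "\<And>k. sym (E k)"
    and Bt: "Bt > 0" and conn: "\<And>t. connected_graph (\<Union>l\<in>{t * Bt..(t + 1) * Bt - 1}. E l)"
    and B: "B = 2 * Bt - 1"
    and tau: "\<tau> > 0" "\<tau> \<le> 1" "\<And>k i j. W k $ i $ j > 0 \<Longrightarrow> \<tau> \<le> W k $ i $ j"
    and step: "\<And>k. v (Suc k) = W k ** v k + e k"
    and zero: "\<And>k. row_avg (v k) = 0"
  shows "norm (v (k + B)) \<le> (1 - \<tau> / (4 * (real CARD('n))\<^sup>2)) * norm (v k) + (\<Sum>j<B. norm (e (k + j)))"
proof -
  define P where "P = rec_nat (v k) (\<lambda>j M. W (k + j) ** M)"
  have P0: "P 0 = v k" and PS: "P (Suc j) = W (k + j) ** P j" for j by (simp_all add: P_def)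
  have P_avg: "row_avg (P j) = 0" for j
    by (induction j) (simp_all add: P0 PS zero row_avg_mixing[OF mix])
  have P_mono: "norm (P (j + i)) \<le> norm (P j)" for i j
    by (induction i) (auto simp: PS intro: order_trans[OF norm_mixing_le[OF mix]])
  have diff: "norm (v (k + j) - P j) \<le> (\<Sum>i<j. norm (e (k + i)))" for j
  proof (induction j)
    case (Suc j)
    have "v (k + Suc j) - P (Suc j) = W (k + j) ** (v (k + j) - P j) + e (k + j)"
      by (simp add: step PS matrix_mult_diff_right)
    also have "norm \<dots> \<le> norm (v (k + j) - P j) + norm (e (k + j))"
      by (intro norm_triangle_le add_right_mono norm_mixing_le[OF mix])
    finally show ?case using Suc by simp
  qed (simp add: P0)
  \<comment> \<open>\<open>t\<close> is \<open>k / Bt\<close> rounded up, so \<open>s\<close> is the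
    first block start not before \<open>k\<close>. At most \<open>Bt - 1\<close> steps precede it,
    and the block ends by \<open>k + 2 * Bt - 1 = k + B\<close>.\<close>
  define t where "t = (k + Bt - 1) div Bt"
  define s where "s = t * Bt"
  have "k + Bt - 1 = s + (k + Bt - 1) mod Bt" by (simp add: s_def t_def)
  moreover have "(k + Bt - 1) mod Bt < Bt" using Bt by simp
  ultimately have s: "k \<le> s" "s + Bt \<le> k + B" using B Bt by linarith+
  define s' where "s' = s - k"
  \<comment> \<open>The window splits into the steps before the block, the block and a remainder;
    only the block has to contract.\<close>
  have ks': "k + s' = s" and s'B: "B = s' + Bt + (B - s' - Bt)" using s by (simp_all add: s'_def)
  have "norm (P B) \<le> norm (P (s' + Bt))" by (subst s'B) (rule P_mono)
  also have "\<dots> \<le> (1 - \<tau> / (4 * (real CARD('n))\<^sup>2)) * norm (P (s' + 0))"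
  proof (rule matrix_consensus_contraction[where E = "\<lambda>l. E (s + l)" and W = "\<lambda>l. W (s + l)"
        and u = "\<lambda>l. P (s' + l)"])
    have "(\<Union>l<Bt. E (s + l)) = (\<Union>l\<in>(+) s ` {..<Bt}. E l)"
      by (simp add: image_image)
    also have "(+) s ` {..<Bt} = {s..s + Bt - 1}"
      using Bt by (auto simp: lessThan_atLeast0)
    finally show "connected_graph (\<Union>l<Bt. E (s + l))"
      using conn[of t] by (simp add: s_def add.commute)
    show "P (s' + Suc l) = W (s + l) ** P (s' + l)" for l
      using PS[of "s' + l"] by (simp add: ks'[symmetric] add.assoc)
  qed (use mix sym tau P_avg in auto)
  also have "\<dots> \<le> (1 - \<tau> / (4 * (real CARD('n))\<^sup>2)) * norm (P 0)"
  proof (rule mult_left_mono)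
    show "0 \<le> 1 - \<tau> / (4 * (real CARD('n))\<^sup>2)"
      by (rule contraction_factor_nonneg[OF tau(2)])
    show "norm (P (s' + 0)) \<le> norm (P 0)" using P_mono[of 0 s'] by simp
  qed
  finally have "norm (P B) \<le> (1 - \<tau> / (4 * (real CARD('n))\<^sup>2)) * norm (v k)" by (simp add: P0)
  moreover have "norm (v (k + B)) \<le> norm (v (k + B) - P B) + norm (P B)"
    using norm_triangle_ineq[of "v (k + B) - P B" "P B"] by simp
  ultimately show ?thesis using diff[of B] by linarith
qed

subsection \<open>Gradient steps\<close>

lemma GDERIV_line:
  assumes "\<And>x. GDERIV F x :> G x"
  shows "((\<lambda>t. F (v + t *\<^sub>R d)) has_real_derivative G (v + t *\<^sub>R d) \<bullet> d) (at t)"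
proof -
  have "((\<lambda>t. F (v + t *\<^sub>R d)) has_derivative (\<lambda>s. (s *\<^sub>R d) \<bullet> G (v + t *\<^sub>R d))) (at t)"
    by (rule has_derivative_compose[OF _ assms[unfolded gderiv_def]])
      (auto intro!: derivative_eq_intros)
  then show ?thesis
    by (simp add: has_field_derivative_def inner_commute mult_commute_abs)
qed

text \<open>The descent lemma. Along the segment, \<open>F\<close> minus its quadratic model has
  nonpositive derivative, by Cauchy-Schwarz and the Lipschitz bound.\<close>

lemma lipschitz_gradient_upper_bound:
  assumes G: "\<And>x. GDERIV F x :> G x" and lip: "\<And>x y. norm (G x - G y) \<le> L * norm (x - y)"
  shows "F (v + d) \<le> F v + G v \<bullet> d + L / 2 * (norm d)\<^sup>2"
proof -
  define h where "h t = F (v + t *\<^sub>R d) - t * (G v \<bullet> d) - L / 2 * t\<^sup>2 * (norm d)\<^sup>2" for t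
  have "h 1 \<le> h 0"
  proof (rule DERIV_nonpos_imp_nonincreasing[of 0 1 h])
    fix t :: real assume t: "0 \<le> t" "t \<le> 1"
    have "(h has_real_derivative (G (v + t *\<^sub>R d) \<bullet> d - G v \<bullet> d - L * t * (norm d)\<^sup>2)) (at t)"
      unfolding h_def by (auto intro!: derivative_eq_intros GDERIV_line[OF G])
    moreover have "G (v + t *\<^sub>R d) \<bullet> d - G v \<bullet> d \<le> L * t * (norm d)\<^sup>2"
    proof -
      have "G (v + t *\<^sub>R d) \<bullet> d - G v \<bullet> d = (G (v + t *\<^sub>R d) - G v) \<bullet> d"
        by (simp add: inner_diff_left)
      also have "\<dots> \<le> norm (G (v + t *\<^sub>R d) - G v) * norm d" by (rule norm_cauchy_schwarz)
      also have "\<dots> \<le> L * norm (v + t *\<^sub>R d - v) * norm d"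
        by (intro mult_right_mono lip) auto
      finally show ?thesis using t by (simp add: power2_eq_square mult_ac)
    qed
    ultimately show "\<exists>y. (h has_real_derivative y) (at t) \<and> y \<le> 0"
      by (intro exI[of _ "G (v + t *\<^sub>R d) \<bullet> d - G v \<bullet> d - L * t * (norm d)\<^sup>2"]) simp
  qed simp
  then show ?thesis by (simp add: h_def)
qed

text \<open>Uniqueness is part of the argument, since \<open>z\<close> is given by a definite
  description: the convexity bound at a minimizer, where the gradient vanishes, forces any other
  minimizer to coincide with it.\<close>

lemma strongly_convex_minimizer:
  fixes F :: "'a::euclidean_space \<Rightarrow> real"
  assumes G: "\<And>x. GDERIV F x :> G x" and mu: "\<mu> > 0"
    and conv: "\<And>x y. F y + G y \<bullet> (x - y) + \<mu> / 2 * (norm (x - y))\<^sup>2 \<le> F x"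
    and z: "z = (THE z. is_arg_min F (\<lambda>_. True) z)"
  shows "F z \<le> F x" and "G z = 0"
proof -
  have zero: "G w = 0" if "\<And>x. F w \<le> F x" for w
  proof -
    have "(\<lambda>h. h \<bullet> G w) = (\<lambda>h. 0)"
      by (rule differential_zero_maxmin[of w UNIV F]) (use that G[unfolded gderiv_def] in auto)
    then have "G w \<bullet> G w = 0" by meson
    then show ?thesis by simp
  qed
  have ex: "\<exists>w. \<forall>x. F w \<le> F x"
  proof -
    \<comment> \<open>Beyond radius \<open>R\<close> the term
      \<open>\<mu> / 2 * (norm x)\<^sup>2\<close> outweighs \<open>norm (G 0) * norm x\<close> in
      the lower bound around 0, so \<open>F x \<ge> F 0\<close> there and a minimizer over the ball
      is global.\<close>
    define R where "R = 2 * norm (G 0) / \<mu>"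
    have "R \<ge> 0" using mu by (simp add: R_def)
    have "continuous_on (cball 0 R) F"
      using G unfolding gderiv_def
      by (intro continuous_at_imp_continuous_on ballI) (rule has_derivative_continuous)
    then obtain w where w: "\<And>x. x \<in> cball 0 R \<Longrightarrow> F w \<le> F x"
      using continuous_attains_inf[OF compact_cball, of 0 R F] \<open>R \<ge> 0\<close>
      by (metis cball_eq_empty not_less)
    have "F w \<le> F x" for x
    proof (cases "norm x \<le> R")
      case False
      have "F w \<le> F 0" using w \<open>R \<ge> 0\<close> by simp
      moreover have "0 \<le> norm x * (\<mu> / 2 * norm x - norm (G 0))"
        using False mu by (intro mult_nonneg_nonneg) (simp_all add: R_def field_simps)
      moreover have "- (norm (G 0) * norm x) \<le> G 0 \<bullet> x"
        using Cauchy_Schwarz_ineq2[of "G 0" x] by linarith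
      ultimately show ?thesis
        using conv[of 0 x] by (simp add: power2_eq_square algebra_simps)
    qed (use w in simp)
    then show ?thesis by blast
  qed
  then obtain w where w: "\<And>x. F w \<le> F x" by blast
  have "is_arg_min F (\<lambda>_. True) w" using w by (auto simp: is_arg_min_def not_less)
  moreover have "w' = w" if "is_arg_min F (\<lambda>_. True) w'" for w'
  proof -
    have "F w' \<le> F w" using that by (auto simp: is_arg_min_def not_less)
    with conv[of w w'] zero[OF w] have "\<mu> / 2 * (norm (w' - w))\<^sup>2 \<le> 0" by simp
    then show ?thesis using mu by (simp add: mult_le_0_iff)
  qed
  ultimately have "z = w" unfolding z by (rule the_equality)
  then show "F z \<le> F x" "G z = 0" using w zero by auto
qed

text \<open>Strong convexity at \<open>x\<close>, together with a lower bound on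
  \<open>F x - F z\<close>, bounds \<open>g \<bullet> e\<close> from below by a multiple of the
  squared gradient plus a multiple of the squared distance. In the expanded square the first absorbs
  \<open>\<alpha>\<^sup>2 * (norm g)\<^sup>2\<close>, as \<open>\<alpha> * L \<le> 1\<close>, and
  the second gives the contraction.\<close>

lemma gradient_step_contraction:
  assumes G: "\<And>x. GDERIV F x :> G x" and lip: "\<And>x y. norm (G x - G y) \<le> L * norm (x - y)"
    and conv: "\<And>x y. F y + G y \<bullet> (x - y) + \<mu> / 2 * (norm (x - y))\<^sup>2 \<le> F x"
    and min: "\<And>x. F z \<le> F x"
    and L: "L > 0" and alpha: "\<alpha> \<ge> 0" "\<alpha> * L \<le> 1"
  shows "(norm (x - \<alpha> *\<^sub>R G x - z))\<^sup>2 \<le> (1 - \<alpha> * \<mu>) * (norm (x - z))\<^sup>2"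
proof -
  define g e where "g = G x" and "e = x - z"
  \<comment> \<open>Minimality is tested at the gradient step of length \<open>1 / L\<close>, which
    minimizes the quadratic upper model.\<close>
  have "F z \<le> F (x + (- 1 / L) *\<^sub>R g)" by (rule min)
  also have "\<dots> \<le> F x + G x \<bullet> ((- 1 / L) *\<^sub>R g) + L / 2 * (norm ((- 1 / L) *\<^sub>R g))\<^sup>2"
    by (rule lipschitz_gradient_upper_bound[OF G lip])
  also have "\<dots> = F x - (norm g)\<^sup>2 / (2 * L)"
    using L by (simp add: g_def power_divide power2_norm_eq_inner) (simp add: field_simps power2_eq_square)
  finally have "(norm g)\<^sup>2 / (2 * L) \<le> F x - F z" by simp
  moreover have "F x + g \<bullet> (z - x) + \<mu> / 2 * (norm (z - x))\<^sup>2 \<le> F z"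
    unfolding g_def by (rule conv)
  ultimately have "(norm g)\<^sup>2 / (2 * L) + \<mu> / 2 * (norm e)\<^sup>2 \<le> g \<bullet> e"
    by (simp add: e_def inner_diff_right norm_minus_commute)
  from mult_left_mono[OF this, of "2 * \<alpha>"] alpha(1)
  have "2 * \<alpha> * ((norm g)\<^sup>2 / (2 * L) + \<mu> / 2 * (norm e)\<^sup>2) \<le> 2 * \<alpha> * (g \<bullet> e)"
    by simp
  moreover have "2 * \<alpha> * ((norm g)\<^sup>2 / (2 * L) + \<mu> / 2 * (norm e)\<^sup>2)
      = \<alpha> * (norm g)\<^sup>2 / L + \<alpha> * \<mu> * (norm e)\<^sup>2"
    using L by (simp add: field_simps)
  moreover have "\<alpha>\<^sup>2 * (norm g)\<^sup>2 \<le> \<alpha> * (norm g)\<^sup>2 / L"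
  proof -
    have "\<alpha> * (norm g)\<^sup>2 * (\<alpha> * L) \<le> \<alpha> * (norm g)\<^sup>2 * 1"
      using alpha by (intro mult_left_mono) auto
    then show ?thesis using L by (simp add: field_simps power2_eq_square)
  qed
  moreover have "(norm (x - \<alpha> *\<^sub>R G x - z))\<^sup>2 = (norm e)\<^sup>2 - 2 * \<alpha> * (g \<bullet> e) + \<alpha>\<^sup>2 * (norm g)\<^sup>2"
  proof -
    have "x - \<alpha> *\<^sub>R G x - z = e - \<alpha> *\<^sub>R g" by (simp add: e_def g_def)
    show ?thesis
      unfolding \<open>x - \<alpha> *\<^sub>R G x - z = e - \<alpha> *\<^sub>R g\<close>
      by (simp add: power2_norm_eq_inner inner_diff_left inner_diff_right inner_commute
          power2_eq_square[of \<alpha>] algebra_simps)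
  qed
  ultimately show ?thesis by (simp add: e_def[symmetric] algebra_simps)
qed

subsection \<open>Coupled recursions and the step size\<close>

text \<open>A small-gain argument: the weights \<open>pa\<close>, \<open>pb\<close>,
  \<open>pc\<close> turn the coupled recursions into simultaneous bounds with one common constant,
  which strong induction propagates.\<close>

lemma geometric_decay_of_coupled_sequences:
  fixes a b c :: "nat \<Rightarrow> real"
  assumes B: "B > 0" and lam: "0 < r" "r \<le> 1"
    and pos: "pa > 0" "pb > 0" "pc > 0"
    and nonneg: "\<And>k. a k \<ge> 0" "\<And>k. b k \<ge> 0" "\<And>k. c k \<ge> 0"
    and coeff: "\<delta> \<ge> 0" "\<alpha> \<ge> 0" "za \<ge> 0" "zb \<ge> 0" "zc \<ge> 0" "\<rho> \<ge> 0" "\<sigma> \<ge> 0"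
    and a: "\<And>k. a (k + B) \<le> \<delta> * a k + \<alpha> * (\<Sum>j<B. b (k + j))"
    and b: "\<And>k. b (k + B) \<le> \<delta> * b k + (\<Sum>j<B. za * a (k + j) + zb * b (k + j) + zc * c (k + j))"
    and c: "\<And>k. c (Suc k) \<le> \<rho> * c k + \<sigma> * a k"
    and gain_a: "\<delta> * pa + \<alpha> * (real B * pb) \<le> r ^ B * pa"
    and gain_b: "\<delta> * pb + real B * (za * pa + zb * pb + zc * pc) \<le> r ^ B * pb"
    and gain_c: "\<rho> * pc + \<sigma> * pa \<le> r * pc"
  shows "\<exists>M. \<forall>k. a k \<le> M * pa * r ^ k \<and> b k \<le> M * pb * r ^ k \<and> c k \<le> M * pc * r ^ k"
proof -
  \<comment> \<open>\<open>M\<close> sums the normalized values over the first \<open>B\<close>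
    indices, so it dominates each of them and starts the induction.\<close>
  define m where "m k = a k / (pa * r ^ k) + b k / (pb * r ^ k) + c k / (pc * r ^ k)" for k
  define M where "M = (\<Sum>k<B. m k)"
  have m_nonneg: "m k \<ge> 0" for k
    unfolding m_def using nonneg pos lam by (intro add_nonneg_nonneg divide_nonneg_nonneg) auto
  have M_nonneg: "M \<ge> 0" unfolding M_def by (intro sum_nonneg m_nonneg)
  have base: "a k \<le> M * pa * r ^ k \<and> b k \<le> M * pb * r ^ k \<and> c k \<le> M * pc * r ^ k"
    if "k < B" for k
  proof -
    have "m k \<le> M" unfolding M_def using that m_nonneg by (intro member_le_sum) auto
    moreover have "0 \<le> a k / (pa * r ^ k)" "0 \<le> b k / (pb * r ^ k)" "0 \<le> c k / (pc * r ^ k)"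
      using nonneg pos lam by auto
    ultimately have "a k / (pa * r ^ k) \<le> M" "b k / (pb * r ^ k) \<le> M" "c k / (pc * r ^ k) \<le> M"
      unfolding m_def by linarith+
    then show ?thesis using pos lam by (simp add: divide_le_eq mult.assoc)
  qed
  have "a k \<le> M * pa * r ^ k \<and> b k \<le> M * pb * r ^ k \<and> c k \<le> M * pc * r ^ k" for k
  proof (induction k rule: less_induct)
    case (less k)
    show ?case
    proof (cases "k < B")
      case False
      define l where "l = k - B"
      have k: "k = l + B" using False by (simp add: l_def)
      define X where "X = M * r ^ l"
      have X: "X \<ge> 0" using M_nonneg lam by (simp add: X_def)
      have IH: "a (l + j) \<le> X * pa" "b (l + j) \<le> X * pb" "c (l + j) \<le> X * pc" if "j < B" for j
      proof -
        \<comment> \<open>As \<open>r \<le> 1\<close>, the bound at the start of the window serves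
          for all its indices.\<close>
        have "r ^ (l + j) \<le> r ^ l" using lam by (intro power_decreasing) auto
        then have "M * p * r ^ (l + j) \<le> X * p" if "p > 0" for p
          using M_nonneg that unfolding X_def by (simp add: mult_ac mult_left_mono)
        note this[OF pos(1)] this[OF pos(2)] this[OF pos(3)]
        then show "a (l + j) \<le> X * pa" "b (l + j) \<le> X * pb" "c (l + j) \<le> X * pc"
          using less[of "l + j"] that k by (meson add_less_cancel_left order_trans)+
      qed
      have IH0: "a l \<le> X * pa" "b l \<le> X * pb" using IH[of 0] B by simp_all
      have "a k \<le> \<delta> * a l + \<alpha> * (\<Sum>j<B. b (l + j))" unfolding k by (rule a)
      also have "\<dots> \<le> \<delta> * (X * pa) + \<alpha> * (\<Sum>j<B. X * pb)"
        using coeff IH IH0 by (intro add_mono mult_left_mono sum_mono) auto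
      also have "\<dots> = X * (\<delta> * pa + \<alpha> * (real B * pb))" by (simp add: algebra_simps)
      also have "\<dots> \<le> X * (r ^ B * pa)" by (intro mult_left_mono gain_a X)
      finally have 1: "a k \<le> M * pa * r ^ k" by (simp add: X_def k power_add mult_ac)
      have "b k \<le> \<delta> * b l + (\<Sum>j<B. za * a (l + j) + zb * b (l + j) + zc * c (l + j))"
        unfolding k by (rule b)
      also have "\<dots> \<le> \<delta> * (X * pb) + (\<Sum>j<B. za * (X * pa) + zb * (X * pb) + zc * (X * pc))"
        using coeff IH IH0 by (intro add_mono mult_left_mono sum_mono) auto
      also have "\<dots> = X * (\<delta> * pb + real B * (za * pa + zb * pb + zc * pc))" by (simp add: algebra_simps)
      also have "\<dots> \<le> X * (r ^ B * pb)" by (intro mult_left_mono gain_b X)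
      finally have 2: "b k \<le> M * pb * r ^ k" by (simp add: X_def k power_add mult_ac)
      \<comment> \<open>The recursion for \<open>c\<close> spans a single step, so here the
        induction goes back one index instead of \<open>B\<close>.\<close>
      obtain j where j: "k = Suc j" using False B by (cases k) auto
      have "c k \<le> \<rho> * c j + \<sigma> * a j" unfolding j by (rule c)
      also have "\<dots> \<le> \<rho> * (M * pc * r ^ j) + \<sigma> * (M * pa * r ^ j)"
        using coeff less[of j] j by (intro add_mono mult_left_mono) auto
      also have "\<dots> = M * r ^ j * (\<rho> * pc + \<sigma> * pa)" by (simp add: algebra_simps)
      also have "\<dots> \<le> M * r ^ j * (r * pc)" using M_nonneg lam by (intro mult_left_mono gain_c) auto
      finally have "c k \<le> M * pc * r ^ k" by (simp add: j mult_ac)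
      with 1 2 show ?thesis by blast
    qed (rule base)
  qed
  then show ?thesis by blast
qed

text \<open>All the numerical facts about the step size. The last inequality is what remains of the
  gain condition for \<open>b\<close> once the weights of \<open>b\<close> and \<open>c\<close>
  relative to \<open>a\<close> are chosen as \<open>\<eta> / (\<alpha> * B)\<close> and
  \<open>\<alpha> * L / (r - \<rho>)\<close>.\<close>

lemma gain_condition:
  fixes n \<kappa> L \<mu> \<tau> D \<alpha> \<eta> \<rho> r :: real and B :: nat
  assumes n: "n \<ge> 1" and B: "B \<ge> 1" and L: "L > 0" and mu: "\<mu> > 0"
    and kappa: "\<kappa> = L / \<mu>" "\<kappa> \<ge> 1" and tau: "\<tau> > 0" "\<tau> \<le> 1"
    and D: "D = \<tau>\<^sup>2 / (128 * (real B)\<^sup>2 * n powr 4.5 * \<kappa> powr 1.5)"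
    and alpha: "\<alpha> = 3 * \<tau>\<^sup>2 / (128 * (real B)\<^sup>2 * n powr 4.5 * L * sqrt \<kappa>) - 1.5 / \<mu> * D\<^sup>2"
    and eta: "\<eta> = \<tau> / (4 * n\<^sup>2) - D"
    and rho: "\<rho> = 1 - \<alpha> * \<mu> / 2" and r: "r \<ge> 1 - D"
  shows "D > 0" and "D \<le> 1 / 128" and "\<alpha> > 0" and "\<alpha> * L \<le> 1" and "\<alpha> * \<mu> \<le> 1"
    and "\<eta> > 0" and "\<rho> < r"
    and "\<alpha> * L * (real B)\<^sup>2 * (2 + \<alpha> * L + \<eta> + (\<alpha> * L)\<^sup>2 / (r - \<rho>)) \<le> \<eta>\<^sup>2"
proof -
  define s q m T where "s = sqrt n" and "q = sqrt \<kappa>" and "m = 128 * (real B)\<^sup>2 * n ^ 4 * s"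
    and "T = \<tau> / n\<^sup>2"
  have s: "s \<ge> 1" and q: "q \<ge> 1" "q\<^sup>2 = \<kappa>" using n kappa by (simp_all add: s_def q_def)
  have Bge: "real B \<ge> 1" using B by simp
  have m: "m > 0" using B n s by (simp add: m_def)
  have n_powr: "n powr 4.5 = n ^ 4 * s"
    using n powr_add[of n 4 "1/2"] by (simp add: s_def powr_half_sqrt)
  have k_powr: "\<kappa> powr 1.5 = \<kappa> * q"
    using kappa(2) powr_add[of \<kappa> 1 "1/2"] by (simp add: q_def powr_half_sqrt)
  have D': "D = \<tau>\<^sup>2 / (m * \<kappa> * q)" unfolding D n_powr k_powr m_def by (simp add: mult_ac)
  show D_pos: "D > 0" using m q kappa(2) tau by (simp add: D')
  have "3 * \<tau>\<^sup>2 / (128 * (real B)\<^sup>2 * n powr 4.5 * L * sqrt \<kappa>) * \<mu> = 3 * D"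
    using L mu m q(1) unfolding D' n_powr q_def[symmetric]
    unfolding kappa(1) m_def by (simp add: mult_ac)
  then have alpha_mu: "\<alpha> * \<mu> = 3 * D - 1.5 * D\<^sup>2"
    using mu by (simp add: alpha left_diff_distrib)
  have alpha_L: "\<alpha> * L = \<alpha> * \<mu> * \<kappa>" using mu by (simp add: kappa(1))
  have T: "T > 0" "T \<le> 1"
  proof -
    have "\<tau> \<le> n\<^sup>2" using tau one_le_power[OF n, of 2] by linarith
    then show "T \<le> 1" using n by (simp add: T_def divide_le_eq)
  qed (use tau n in \<open>simp add: T_def\<close>)
  have T2: "T\<^sup>2 \<le> T" "T\<^sup>2 \<le> 1" using T power_decreasing[of 1 2 T] by (auto simp: power_le_one)
  have "\<tau>\<^sup>2 = T\<^sup>2 * n ^ 4" using n by (simp add: T_def power_divide flip: power_mult)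
  \<comment> \<open>From this identity two estimates follow: discarding \<open>q * s\<close> bounds
    the leading term, and discarding \<open>B * s\<close> but keeping \<open>q\<close> bounds the
    cubic term.\<close>
  then have DB: "D * \<kappa> * q * ((real B)\<^sup>2 * s) = T\<^sup>2 / 128"
    using m q kappa(2) n s B by (simp add: D' m_def)
  have DkB: "D * \<kappa> * (real B)\<^sup>2 \<le> T\<^sup>2 / 128"
  proof -
    have "D * \<kappa> * (real B)\<^sup>2 * 1 \<le> D * \<kappa> * (real B)\<^sup>2 * (q * s)"
      using D_pos kappa(2) q(1) s mult_mono[of 1 q 1 s] by (intro mult_left_mono) auto
    then show ?thesis using DB by (simp add: mult_ac)
  qed
  have DkqB: "D * \<kappa> * q * real B \<le> T\<^sup>2 / 128"
  proof -
    have "1 * 1 \<le> real B * s" using Bge s by (intro mult_mono) auto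
    then have "D * \<kappa> * q * real B * 1 \<le> D * \<kappa> * q * real B * (real B * s)"
      using D_pos kappa(2) q(1) by (intro mult_left_mono) auto
    then show ?thesis using DB by (simp add: mult_ac power2_eq_square)
  qed
  have "D * \<kappa> * 1 \<le> D * \<kappa> * (real B)\<^sup>2"
    using D_pos kappa(2) one_le_power[OF Bge, of 2] by (intro mult_left_mono) auto
  then have Dk: "D * \<kappa> \<le> T\<^sup>2 / 128" using DkB by simp
  have "D * 1 \<le> D * \<kappa>" using D_pos kappa(2) by (intro mult_left_mono) auto
  then have D_T2: "D \<le> T\<^sup>2 / 128" using Dk by simp
  then show D_le: "D \<le> 1 / 128" using T2 by simp
  have D2: "D\<^sup>2 \<le> D / 128"
    using mult_left_mono[OF D_le, of D] D_pos by (simp add: power2_eq_square)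
  have amu: "0 < \<alpha> * \<mu>" "\<alpha> * \<mu> \<le> 3 * D" using D2 D_pos by (auto simp: alpha_mu)
  then show a_pos: "\<alpha> > 0" using mu by (simp add: zero_less_mult_iff)
  define A where "A = \<alpha> * L"
  have A_pos: "A > 0" using a_pos L by (simp add: A_def)
  have A: "A \<le> 3 * (D * \<kappa>)"
    unfolding A_def alpha_L using mult_right_mono[OF amu(2), of \<kappa>] kappa(2) by simp
  then have A_le: "A \<le> 3 / 128" using Dk T2 by simp
  then show "\<alpha> * L \<le> 1" by (simp add: A_def)
  show "\<alpha> * \<mu> \<le> 1" using amu D_le by simp
  have eta': "\<eta> = T / 4 - D" by (simp add: eta T_def)
  \<comment> \<open>\<open>31 / 128\<close> is \<open>1 / 4 - 1 / 128\<close>, from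
    \<open>D \<le> T\<^sup>2 / 128 \<le> T / 128\<close>.\<close>
  have eta_ge: "\<eta> \<ge> 31 / 128 * T" and eta_le: "\<eta> \<le> 1 / 4"
    using D_T2 T2 T D_pos by (simp_all add: eta')
  show "\<eta> > 0" using eta_ge T by simp
  \<comment> \<open>\<open>r - \<rho>\<close> is at least \<open>\<alpha> * \<mu> / 2 - D\<close>,
    which equals \<open>0.5 * D - 0.75 * D\<^sup>2\<close>.\<close>
  have r_rho: "r - \<rho> \<ge> 0.49 * D" using r D2 D_pos unfolding rho alpha_mu by (simp add: field_simps)
  then show "\<rho> < r" using D_pos by simp
  have AB: "A * (real B)\<^sup>2 \<le> 3 / 128 * T\<^sup>2"
    using mult_right_mono[OF A, of "(real B)\<^sup>2"] DkB by simp
  \<comment> \<open>The quotient by \<open>r - \<rho>\<close> costs a factor of order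
    \<open>1 / D\<close>; the cubic term supplies a factor \<open>D\<close> because
    \<open>\<kappa> = q\<^sup>2\<close> lets two of its three factors be squared as
    \<open>D * \<kappa> * q * B\<close>. The constant 0.0034 is an upper bound for
    \<open>27 / 16384 / 0.49\<close>.\<close>
  have "A * (real B)\<^sup>2 * A\<^sup>2 \<le> 27 / 16384 * D * T\<^sup>2"
  proof -
    have "A ^ 3 \<le> (3 * (D * \<kappa>)) ^ 3" using A A_pos by (intro power_mono) auto
    then have "A ^ 3 * (real B)\<^sup>2 \<le> (3 * (D * \<kappa>)) ^ 3 * (real B)\<^sup>2"
      by (rule mult_right_mono) simp
    also have "\<dots> = 27 * D * (D * \<kappa> * q * real B)\<^sup>2"
      by (simp add: q(2)[symmetric] power_mult_distrib power2_eq_square power3_eq_cube)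
    also have "\<dots> \<le> 27 * D * (T\<^sup>2 / 128)\<^sup>2"
      using DkqB D_pos kappa(2) q(1) by (intro mult_left_mono power_mono) auto
    also have "\<dots> \<le> 27 * D * (T\<^sup>2 / 16384)"
      using D_pos T2 mult_left_mono[OF T2(2), of "T\<^sup>2"]
      by (intro mult_left_mono) (auto simp: power_divide power2_eq_square[of "T\<^sup>2"])
    finally show ?thesis by (simp add: power2_eq_square power3_eq_cube mult_ac)
  qed
  also have "\<dots> \<le> 0.0034 * T\<^sup>2 * (0.49 * D)" using D_pos by (simp add: field_simps)
  also have "\<dots> \<le> 0.0034 * T\<^sup>2 * (r - \<rho>)" using r_rho by (intro mult_left_mono) auto
  finally have A3: "A * (real B)\<^sup>2 * A\<^sup>2 / (r - \<rho>) \<le> 0.0034 * T\<^sup>2"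
    using r_rho D_pos by (subst pos_divide_le_eq) auto
  have "A * (real B)\<^sup>2 * (2 + A + \<eta> + A\<^sup>2 / (r - \<rho>))
      = A * (real B)\<^sup>2 * (2 + A + \<eta>) + A * (real B)\<^sup>2 * A\<^sup>2 / (r - \<rho>)"
    by (simp add: distrib_left)
  also have "\<dots> \<le> 3 / 128 * T\<^sup>2 * (2 + 3 / 128 + 1 / 4) + 0.0034 * T\<^sup>2"
    using A_pos A_le eta_le eta_ge T by (intro add_mono mult_mono AB A3) auto
  also have "\<dots> \<le> (31 / 128 * T)\<^sup>2" by (simp add: power_mult_distrib field_simps)
  also have "\<dots> \<le> \<eta>\<^sup>2" using eta_ge T by (intro power_mono) auto
  finally show "\<alpha> * L * (real B)\<^sup>2 * (2 + \<alpha> * L + \<eta> + (\<alpha> * L)\<^sup>2 / (r - \<rho>)) \<le> \<eta>\<^sup>2"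
    by (simp add: A_def)
qed

subsection \<open>Convergence of DIGing\<close>

lemma stacked_gradient_lipschitz:
  fixes f :: "'n::finite \<Rightarrow> real ^ 'p \<Rightarrow> real"
  assumes "\<And>i u v. norm (gradient (f i) u - gradient (f i) v) \<le> K * norm (u - v)" and "K \<ge> 0"
  shows "norm (stacked_gradient f M - stacked_gradient f N) \<le> K * norm (M - N)"
proof -
  have "norm (stacked_gradient f M - stacked_gradient f N)
      \<le> L2_set (\<lambda>i. K * norm ((M - N) $ i)) UNIV"
    unfolding norm_vec_def[where 'b = 'n]
    by (rule L2_set_mono) (simp_all add: stacked_gradient_def assms)
  also have "\<dots> = K * norm (M - N)"
    using assms(2) by (simp add: norm_vec_def[where 'b = 'n] L2_set_right_distrib)
  finally show ?thesis .
qed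

text \<open>Adding the convexity inequalities for a nonzero vector and 0 in both directions bounds
  the modulus by the monotonicity of the gradient, which smoothness limits. This yields
  \<open>\<kappa>bar \<ge> 1\<close>.\<close>

lemma strong_convexity_le_smoothness:
  fixes f :: "real ^ 'p \<Rightarrow> real"
  assumes smooth: "\<And>u v. norm (gradient f u - gradient f v) \<le> L * norm (u - v)"
    and convex: "\<And>u v. f u \<ge> f v + gradient f v \<bullet> (u - v) + \<mu> / 2 * (norm (u - v))\<^sup>2"
  shows "\<mu> \<le> L"
proof -
  define g where "g = gradient f"
  define d :: "real ^ 'p" where "d = 1"
  have "\<mu> * (norm d)\<^sup>2 \<le> (g d - g 0) \<bullet> d"
    using convex[of 0 d] convex[of d 0] by (simp add: g_def inner_diff_left)
  also have "\<dots> \<le> norm (g d - g 0) * norm d" by (rule norm_cauchy_schwarz)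
  also have "\<dots> \<le> L * norm d * norm d"
    using smooth[of d 0] by (intro mult_right_mono) (simp_all add: g_def)
  finally have "\<mu> * (norm d)\<^sup>2 \<le> L * (norm d)\<^sup>2" by (simp add: power2_eq_square mult_ac)
  then show ?thesis by (simp add: d_def)
qed

theorem corollary3p10:
  fixes f :: "'n::finite \<Rightarrow> real ^ 'p::finite \<Rightarrow> real"
    and L \<mu> :: "'n \<Rightarrow> real"
    and Lmax \<mu>bar \<kappa>bar n \<tau> \<alpha> lam :: real
    and xstar :: "real ^ 'p"
    and E :: "nat \<Rightarrow> ('n \<times> 'n) set"
    and Bt B :: nat
    and W :: "nat \<Rightarrow> real ^ 'n ^ 'n"
    and x y :: "nat \<Rightarrow> real ^ 'p ^ 'n"
  assumes n: "n = real CARD('n)"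
    and differentiable: "\<And>i z. f i differentiable (at z)"
    and L_pos: "\<And>i. L i > 0"
    and smooth: "\<And>i u v. norm (gradient (f i) u - gradient (f i) v) \<le> L i * norm (u - v)"
    and mu_nonneg: "\<And>i. \<mu> i \<ge> 0"
    and mu_pos: "\<exists>i. \<mu> i > 0"
    and convex: "\<And>i u v. f i u \<ge> f i v + gradient (f i) v \<bullet> (u - v) + \<mu> i / 2 * (norm (u - v))\<^sup>2"
    and Lmax: "Lmax = Max (range L)"
    and mubar: "\<mu>bar = (1 / n) * (\<Sum>i\<in>UNIV. \<mu> i)"
    and kappabar: "\<kappa>bar = Lmax / \<mu>bar"
    and xstar: "xstar = (THE z. is_arg_min (\<lambda>u. (1 / n) * (\<Sum>i\<in>UNIV. f i u)) (\<lambda>_. True) z)"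
    and undirected: "\<And>k. sym (E k)"
    and Bt: "Bt > 0"
    and jointly_connected: "\<And>t. connected_graph (\<Union>l\<in>{t * Bt..(t + 1) * Bt - 1}. E l)"
    and B: "B = 2 * Bt - 1"
    and mixing: "\<And>k. mixing_matrix (E k) (W k)"
    and bounded_below: "\<exists>c>0. \<forall>w\<in>positive_entries W. c \<le> w"
    and tau: "\<tau> = Inf (positive_entries W)"
    and alpha: "\<alpha> = 3 * \<tau>\<^sup>2 / (128 * (real B)\<^sup>2 * n powr 4.5 * Lmax * sqrt \<kappa>bar)
                   - 1.5 / \<mu>bar * (\<tau>\<^sup>2 / (128 * (real B)\<^sup>2 * n powr 4.5 * \<kappa>bar powr 1.5))\<^sup>2"
    and lam: "lam = root B (1 - \<tau>\<^sup>2 / (128 * (real B)\<^sup>2 * n powr 4.5 * \<kappa>bar powr 1.5))"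
    and alg: "DIGing f W \<alpha> x y"
  shows "\<exists>C. \<forall>k. norm (x k - (\<chi> i. xstar)) \<le> C * lam ^ k"
proof -
  define F where "F u = (1 / n) * (\<Sum>i\<in>UNIV. f i u)" for u
  define G where "G u = (1 / n) *\<^sub>R (\<Sum>i\<in>UNIV. gradient (f i) u)" for u
  define g where "g = stacked_gradient f"
  define D where "D = \<tau>\<^sup>2 / (128 * (real B)\<^sup>2 * n powr 4.5 * \<kappa>bar powr 1.5)"
  define \<eta> \<rho> where "\<eta> = \<tau> / (4 * n\<^sup>2) - D" and "\<rho> = 1 - \<alpha> * \<mu>bar / 2"
  define S :: "real ^ 'p \<Rightarrow> real ^ 'p ^ 'n" where "S = stack_rows"

  \<comment> \<open>Bounds on the smoothness and convexity constants\<close>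
  have n1: "n \<ge> 1" unfolding n by (rule one_le_CARD)
  have L_le: "L i \<le> Lmax" for i unfolding Lmax by (intro Max_ge) auto
  have Lmax_pos: "Lmax > 0" using L_pos[of undefined] L_le[of undefined] by linarith
  have smooth': "norm (gradient (f i) u - gradient (f i) v) \<le> Lmax * norm (u - v)" for i u v
    using smooth[of i u v] mult_right_mono[OF L_le[of i], of "norm (u - v)"] by simp
  have mu_le: "\<mu> i \<le> Lmax" for i
    using strong_convexity_le_smoothness[OF smooth convex] L_le[of i] by (rule order_trans)
  have mubar_pos: "\<mu>bar > 0"
  proof -
    obtain i where "\<mu> i > 0" using mu_pos by blast
    then have "(\<Sum>i\<in>UNIV. \<mu> i) > 0" using mu_nonneg by (intro sum_pos2[of _ i]) auto
    then show ?thesis using n1 by (simp add: mubar)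
  qed
  have mubar_le: "\<mu>bar \<le> Lmax"
  proof -
    have "(\<Sum>i\<in>UNIV. \<mu> i) \<le> n * Lmax"
      using sum_mono[of UNIV \<mu> "\<lambda>_. Lmax"] mu_le by (simp add: n)
    then show ?thesis using n1 by (simp add: mubar divide_le_eq mult.commute)
  qed
  have kappa_ge: "\<kappa>bar \<ge> 1" using mubar_pos mubar_le by (simp add: kappabar)

  \<comment> \<open>Positivity and size of the smallest weight\<close>
  have entry_ge: "\<tau> \<le> W k $ i $ j" if "W k $ i $ j > 0" for k i j
    unfolding tau using that bounded_below
    by (intro cInf_lower) (auto simp: positive_entries_def bdd_below_def)
  have diag: "W k $ i $ i > 0" for k i
    using mixing[of k] by (simp add: mixing_matrix_def)
  have tau_pos: "\<tau> > 0"
  proof -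
    obtain c where c: "c > 0" "\<forall>w\<in>positive_entries W. c \<le> w" using bounded_below by blast
    have "W 0 $ i $ i \<in> positive_entries W" for i using diag unfolding positive_entries_def by blast
    then have "c \<le> \<tau>" unfolding tau using c by (intro cInf_greatest) auto
    with c show ?thesis by simp
  qed
  have tau_le: "\<tau> \<le> 1"
  proof -
    fix i :: 'n
    have "\<tau> \<le> W 0 $ i $ i" using entry_ge diag by blast
    also have "\<dots> \<le> (\<Sum>j\<in>UNIV. W 0 $ i $ j)"
      using mixing_matrix_nonneg[OF mixing] by (intro member_le_sum) auto
    finally show ?thesis by (simp add: mixing_matrix_row_sum[OF mixing])
  qed

  \<comment> \<open>Step size and rate\<close>
  have B1: "B \<ge> 1" using B Bt by simp
  have alpha': "\<alpha> = 3 * \<tau>\<^sup>2 / (128 * (real B)\<^sup>2 * n powr 4.5 * Lmax * sqrt \<kappa>bar) - 1.5 / \<mu>bar * D\<^sup>2"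
    by (simp add: alpha D_def)
  note gain = gain_condition[OF n1 B1 Lmax_pos mubar_pos kappabar kappa_ge tau_pos tau_le D_def alpha'
      \<eta>_def \<rho>_def]
  \<comment> \<open>The bounds on \<open>D\<close> do not mention \<open>r\<close>, so they are
    obtained with \<open>r = 1 - D\<close> first; they are needed to show
    \<open>lam \<ge> 1 - D\<close>, after which the other facts are taken with
    \<open>r = lam\<close>.\<close>
  have D: "D > 0" "D \<le> 1 / 128" by (rule gain[OF order_refl])+
  have lam': "lam = root B (1 - D)" by (simp add: lam D_def)
  have lam_pow: "lam ^ B = 1 - D" using B1 D by (simp add: lam')
  have lam_pos: "lam > 0" using B1 D by (simp add: lam')
  have lam_le: "lam \<le> 1" using B1 D by (simp add: lam')
  have lam_ge: "lam \<ge> 1 - D"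
    using power_decreasing[of 1 B lam] B1 lam_pos lam_le lam_pow by simp
  have alpha_pos: "\<alpha> > 0" and alpha_L: "\<alpha> * Lmax \<le> 1" and alpha_mu: "\<alpha> * \<mu>bar \<le> 1"
    and eta_pos: "\<eta> > 0" and rho_less: "\<rho> < lam"
    by (rule gain[OF lam_ge])+
  have rho_nonneg: "\<rho> \<ge> 0" using alpha_mu by (simp add: \<rho>_def)

  \<comment> \<open>The averaged objective and its gradient\<close>
  have GD: "GDERIV F u :> G u" for u
  proof -
    have "((\<lambda>u. (1 / n) * (\<Sum>i\<in>UNIV. f i u)) has_derivative
        (\<lambda>h. (1 / n) * (\<Sum>i\<in>UNIV. h \<bullet> gradient (f i) u))) (at u)"
      using GDERIV_gradient[OF differentiable] unfolding gderiv_def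
      by (intro has_derivative_mult_right has_derivative_sum) auto
    then show ?thesis
      by (simp add: gderiv_def F_def[abs_def] G_def inner_sum_right)
  qed
  have avg_g: "row_avg (g (S v)) = G v" for v
    by (simp add: row_avg_def g_def S_def stacked_gradient_def G_def n)
  have g_lip: "norm (g M - g N) \<le> Lmax * norm (M - N)" for M N
    unfolding g_def by (rule stacked_gradient_lipschitz[OF smooth']) (use Lmax_pos in simp)
  have norm_S: "norm (S v) = sqrt n * norm v" for v by (simp add: S_def norm_stack_rows n)
  have avg_le: "norm (S (row_avg M)) \<le> norm M" for M :: "real ^ 'p ^ 'n"
    unfolding S_def by (rule norm_stack_rows_row_avg_le)
  \<comment> \<open>The stacked bound is used at matrices with equal rows, where the factor
    \<open>sqrt n\<close> cancels.\<close>
  have G_lip: "norm (G u - G v) \<le> Lmax * norm (u - v)" for u v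
  proof -
    have "norm (S (G u - G v)) \<le> norm (g (S u) - g (S v))"
      using avg_le[of "g (S u) - g (S v)"] by (simp add: row_avg_diff avg_g)
    also have "\<dots> \<le> Lmax * norm (S u - S v)" by (rule g_lip)
    also have "S u - S v = S (u - v)" by (simp add: S_def stack_rows_diff)
    finally show ?thesis using n1 by (simp add: norm_S mult.left_commute)
  qed
  have F_conv: "F v + G v \<bullet> (u - v) + \<mu>bar / 2 * (norm (u - v))\<^sup>2 \<le> F u" for u v
  proof -
    have "(\<Sum>i\<in>UNIV. f i v + gradient (f i) v \<bullet> (u - v) + \<mu> i / 2 * (norm (u - v))\<^sup>2)
        \<le> (\<Sum>i\<in>UNIV. f i u)"
      by (intro sum_mono convex)
    then have "(1 / n) * (\<Sum>i\<in>UNIV. f i v + gradient (f i) v \<bullet> (u - v) + \<mu> i / 2 * (norm (u - v))\<^sup>2)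
        \<le> F u"
      unfolding F_def using n1 by (intro mult_left_mono) auto
    then show ?thesis
      by (simp add: F_def G_def mubar sum.distrib inner_sum_left add_divide_distrib
          sum_distrib_right[symmetric] sum_divide_distrib[symmetric])
  qed
  have xstar': "xstar = (THE z. is_arg_min F (\<lambda>_. True) z)"
    by (simp add: xstar F_def[abs_def])
  have F_min: "F xstar \<le> F u" and G_xstar: "G xstar = 0" for u
    by (rule strongly_convex_minimizer[OF GD mubar_pos F_conv xstar'])+

  \<comment> \<open>Gradient tracking and the one-step increment\<close>
  have y0: "y 0 = g (x 0)" and xS: "x (Suc k) = W k ** x k - \<alpha> *\<^sub>R y k"
    and yS: "y (Suc k) = W k ** y k + (g (x (Suc k)) - g (x k))" for k
    using alg by (simp_all add: DIGing_def g_def)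
  \<comment> \<open>Mixing preserves row averages and the gradient increments telescope, so the
    average of \<open>y\<close> always equals the average of the current local gradients.\<close>
  have avg_y: "row_avg (y k) = row_avg (g (x k))" for k
    by (induction k) (simp_all add: y0 yS row_avg_add row_avg_diff row_avg_mixing[OF mixing])

  define a where "a k = norm (deviation (x k))" for k
  define b where "b k = norm (deviation (y k))" for k
  define c where "c k = norm (S (row_avg (x k) - xstar))" for k
  have x_split: "x k = deviation (x k) + S (row_avg (x k))" for k
    by (simp add: deviation_def S_def)
  have dist: "norm (x k - S xstar) \<le> a k + c k" for k
  proof -
    have "x k - S xstar = deviation (x k) + S (row_avg (x k) - xstar)"
      by (subst x_split) (simp add: S_def stack_rows_diff)
    then show ?thesis unfolding a_def c_def by (simp add: norm_triangle_ineq)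
  qed
  have increment: "norm (x (Suc k) - x k) \<le> (2 + \<alpha> * Lmax) * a k + \<alpha> * b k + \<alpha> * Lmax * c k" for k
  proof -
    \<comment> \<open>The consensus part is fixed by mixing and drops out of the increment, leaving
      only deviations and the averaged tracking term.\<close>
    have "W k ** x k = W k ** deviation (x k) + S (row_avg (x k))"
      using mixing_stack_rows[OF mixing, of k "row_avg (x k)"]
      by (simp add: deviation_def S_def matrix_mult_diff_right)
    then have "x (Suc k) - x k
        = W k ** deviation (x k) - deviation (x k) - \<alpha> *\<^sub>R deviation (y k) - \<alpha> *\<^sub>R S (row_avg (y k))"
      by (simp add: xS deviation_def S_def algebra_simps)
    also have "norm \<dots> \<le> norm (W k ** deviation (x k)) + norm (deviation (x k))
        + norm (\<alpha> *\<^sub>R deviation (y k)) + norm (\<alpha> *\<^sub>R S (row_avg (y k)))"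
      by (intro order_trans[OF norm_triangle_ineq4] add_right_mono order_refl)
    also have "\<dots> \<le> a k + a k + \<alpha> * b k + \<alpha> * (Lmax * (a k + c k))"
    proof (intro add_mono)
      show "norm (W k ** deviation (x k)) \<le> a k" unfolding a_def by (rule norm_mixing_le[OF mixing])
      \<comment> \<open>Since \<open>G xstar = 0\<close>, the gradients at \<open>S xstar\<close>
        have average zero and may be subtracted.\<close>
      have "norm (S (row_avg (y k))) = norm (S (row_avg (g (x k) - g (S xstar))))"
        by (simp add: avg_y row_avg_diff avg_g G_xstar)
      also have "\<dots> \<le> norm (g (x k) - g (S xstar))" by (rule avg_le)
      also have "\<dots> \<le> Lmax * norm (x k - S xstar)" by (rule g_lip)
      also have "\<dots> \<le> Lmax * (a k + c k)" using dist Lmax_pos by (intro mult_left_mono) auto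
      finally show "norm (\<alpha> *\<^sub>R S (row_avg (y k))) \<le> \<alpha> * (Lmax * (a k + c k))"
        using alpha_pos by simp
    qed (use alpha_pos in \<open>simp_all add: a_def b_def\<close>)
    finally show ?thesis by (simp add: algebra_simps)
  qed

  \<comment> \<open>Recursions for the three errors\<close>
  have a_rec: "a (k + B) \<le> (1 - \<tau> / (4 * n\<^sup>2)) * a k + \<alpha> * (\<Sum>j<B. b (k + j))" for k
  proof -
    have "norm (deviation (x (k + B))) \<le> (1 - \<tau> / (4 * (real CARD('n))\<^sup>2)) * norm (deviation (x k))
        + (\<Sum>j<B. norm (- \<alpha> *\<^sub>R deviation (y (k + j))))"
      by (rule perturbed_consensus_window[OF mixing undirected Bt jointly_connected B tau_pos tau_le entry_ge,
            where v = "\<lambda>k. deviation (x k)"])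
        (simp_all add: xS deviation_diff deviation_scaleR deviation_mixing[OF mixing])
    then show ?thesis using alpha_pos by (simp add: a_def b_def n sum_distrib_left)
  qed
  have b_rec: "b (k + B) \<le> (1 - \<tau> / (4 * n\<^sup>2)) * b k + (\<Sum>j<B. Lmax * (2 + \<alpha> * Lmax) * a (k + j)
      + Lmax * \<alpha> * b (k + j) + Lmax * (\<alpha> * Lmax) * c (k + j))" for k
  proof -
    have "norm (deviation (y (k + B))) \<le> (1 - \<tau> / (4 * (real CARD('n))\<^sup>2)) * norm (deviation (y k))
        + (\<Sum>j<B. norm (deviation (g (x (Suc (k + j))) - g (x (k + j)))))"
      by (rule perturbed_consensus_window[OF mixing undirected Bt jointly_connected B tau_pos tau_le entry_ge,
            where v = "\<lambda>k. deviation (y k)"])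
        (simp_all add: yS deviation_add deviation_mixing[OF mixing])
    also have "(\<Sum>j<B. norm (deviation (g (x (Suc (k + j))) - g (x (k + j)))))
        \<le> (\<Sum>j<B. Lmax * (2 + \<alpha> * Lmax) * a (k + j) + Lmax * \<alpha> * b (k + j) + Lmax * (\<alpha> * Lmax) * c (k + j))"
    proof (rule sum_mono)
      fix j
      have "norm (deviation (g (x (Suc (k + j))) - g (x (k + j)))) \<le> Lmax * norm (x (Suc (k + j)) - x (k + j))"
        by (rule order_trans[OF norm_deviation_le g_lip])
      also have "\<dots> \<le> Lmax * ((2 + \<alpha> * Lmax) * a (k + j) + \<alpha> * b (k + j) + \<alpha> * Lmax * c (k + j))"
        using Lmax_pos by (intro mult_left_mono increment) simp
      finally show "norm (deviation (g (x (Suc (k + j))) - g (x (k + j))))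
          \<le> Lmax * (2 + \<alpha> * Lmax) * a (k + j) + Lmax * \<alpha> * b (k + j) + Lmax * (\<alpha> * Lmax) * c (k + j)"
        by (simp add: algebra_simps)
    qed
    finally show ?thesis by (simp add: b_def n)
  qed
  have c_rec: "c (Suc k) \<le> \<rho> * c k + \<alpha> * Lmax * a k" for k
  proof -
    define v where "v = row_avg (x k)"
    have "(norm (v - \<alpha> *\<^sub>R G v - xstar))\<^sup>2 \<le> (1 - \<alpha> * \<mu>bar) * (norm (v - xstar))\<^sup>2"
      by (rule gradient_step_contraction[OF GD G_lip F_conv F_min Lmax_pos])
        (use alpha_pos alpha_L in auto)
    also have "\<dots> \<le> \<rho>\<^sup>2 * (norm (v - xstar))\<^sup>2"
    proof (rule mult_right_mono)
      \<comment> \<open>\<open>\<rho>\<close> linearizes the square root of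
        \<open>1 - \<alpha> * \<mu>bar\<close> from above.\<close>
      have "\<rho>\<^sup>2 = 1 - \<alpha> * \<mu>bar + (\<alpha> * \<mu>bar / 2)\<^sup>2" unfolding \<rho>_def power2_diff by simp
      then show "1 - \<alpha> * \<mu>bar \<le> \<rho>\<^sup>2" by simp
    qed simp
    finally have "(norm (v - \<alpha> *\<^sub>R G v - xstar))\<^sup>2 \<le> (\<rho> * norm (v - xstar))\<^sup>2"
      by (simp only: power_mult_distrib)
    then have "norm (v - \<alpha> *\<^sub>R G v - xstar) \<le> \<rho> * norm (v - xstar)"
      by (rule power2_le_imp_le) (use rho_nonneg in simp)
    then have "sqrt n * norm (v - \<alpha> *\<^sub>R G v - xstar) \<le> sqrt n * (\<rho> * norm (v - xstar))"
      using n1 by (intro mult_left_mono) auto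
    then have 1: "norm (S (v - \<alpha> *\<^sub>R G v - xstar)) \<le> \<rho> * c k"
      by (simp add: c_def norm_S v_def mult_ac)
    have "row_avg (g (x k) - g (S v)) = row_avg (y k) - G v"
      by (simp add: avg_y row_avg_diff avg_g)
    then have "norm (S (row_avg (y k) - G v)) \<le> norm (g (x k) - g (S v))" by (metis avg_le)
    also have "\<dots> \<le> Lmax * norm (x k - S v)" by (rule g_lip)
    finally have 2: "norm (S (row_avg (y k) - G v)) \<le> Lmax * a k"
      by (simp add: a_def deviation_def S_def v_def)
    \<comment> \<open>The average makes an exact gradient step on \<open>F\<close>, disturbed by the
      difference between the tracked average and the gradient at the average point.\<close>
    have "row_avg (x (Suc k)) - xstar = (v - \<alpha> *\<^sub>R G v - xstar) - \<alpha> *\<^sub>R (row_avg (y k) - G v)"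
      by (simp add: xS row_avg_diff row_avg_scaleR row_avg_mixing[OF mixing] v_def algebra_simps)
    then have "S (row_avg (x (Suc k)) - xstar)
        = S (v - \<alpha> *\<^sub>R G v - xstar) - \<alpha> *\<^sub>R S (row_avg (y k) - G v)"
      by (simp only: S_def stack_rows_diff stack_rows_scaleR)
    then have "c (Suc k) \<le> norm (S (v - \<alpha> *\<^sub>R G v - xstar)) + \<alpha> * norm (S (row_avg (y k) - G v))"
      unfolding c_def using alpha_pos norm_triangle_ineq4[of "S (v - \<alpha> *\<^sub>R G v - xstar)" "\<alpha> *\<^sub>R S (row_avg (y k) - G v)"]
      by simp
    also have "\<dots> \<le> \<rho> * c k + \<alpha> * (Lmax * a k)"
      using 1 2 alpha_pos by (intro add_mono mult_left_mono) auto
    finally show ?thesis by (simp add: mult.assoc)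
  qed

  \<comment> \<open>Choice of the weights and conclusion\<close>
  define pb pc where "pb = \<eta> / (\<alpha> * real B)" and "pc = \<alpha> * Lmax / (lam - \<rho>)"
  have Bpos: "real B \<ge> 1" using B1 by simp
  have delta: "1 - \<tau> / (4 * n\<^sup>2) = lam ^ B - \<eta>" by (simp add: lam_pow \<eta>_def)
  \<comment> \<open>With weight 1 for \<open>a\<close>, the values of \<open>pb\<close> and
    \<open>pc\<close> make the gain conditions for \<open>a\<close> and \<open>c\<close> equalities,
    so only the condition for \<open>b\<close> is left. Multiplied by \<open>\<alpha> * B\<close> it
    follows from \<open>gain_condition\<close>.\<close>
  have gain_b: "real B * (Lmax * (2 + \<alpha> * Lmax) * 1 + Lmax * \<alpha> * pb + Lmax * (\<alpha> * Lmax) * pc) \<le> \<eta> * pb"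
  proof -
    have "\<alpha> * real B * (real B * (Lmax * (2 + \<alpha> * Lmax) * 1 + Lmax * \<alpha> * pb + Lmax * (\<alpha> * Lmax) * pc))
        = \<alpha> * Lmax * (real B)\<^sup>2 * (2 + \<alpha> * Lmax + \<eta> / real B + (\<alpha> * Lmax)\<^sup>2 / (lam - \<rho>))"
      using alpha_pos Bpos by (simp add: pb_def pc_def power2_eq_square algebra_simps)
    also have "\<dots> \<le> \<alpha> * Lmax * (real B)\<^sup>2 * (2 + \<alpha> * Lmax + \<eta> + (\<alpha> * Lmax)\<^sup>2 / (lam - \<rho>))"
    proof (intro mult_left_mono add_mono order_refl)
      show "\<eta> / real B \<le> \<eta>" using Bpos eta_pos by (simp add: divide_le_eq)
    qed (use alpha_pos Lmax_pos in \<open>auto intro!: mult_nonneg_nonneg\<close>)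
    also have "\<dots> \<le> \<eta>\<^sup>2" by (rule gain(8)[OF lam_ge])
    also have "\<dots> = \<alpha> * real B * (\<eta> * pb)"
      using alpha_pos Bpos by (simp add: pb_def power2_eq_square)
    finally show ?thesis using alpha_pos Bpos by (simp add: mult_le_cancel_left_pos)
  qed
  have "\<exists>M. \<forall>k. a k \<le> M * 1 * lam ^ k \<and> b k \<le> M * pb * lam ^ k \<and> c k \<le> M * pc * lam ^ k"
  proof (rule geometric_decay_of_coupled_sequences[OF _ lam_pos lam_le _ _ _ _ _ _ _ _ _ _ _ _ _ a_rec b_rec c_rec])
    show "B > 0" using B1 by simp
    show "pb > 0" "pc > 0" using eta_pos alpha_pos Bpos Lmax_pos rho_less by (simp_all add: pb_def pc_def)
    show "0 \<le> 1 - \<tau> / (4 * n\<^sup>2)" unfolding n by (rule contraction_factor_nonneg[OF tau_le])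
    show "(1 - \<tau> / (4 * n\<^sup>2)) * 1 + \<alpha> * (real B * pb) \<le> lam ^ B * 1"
      using alpha_pos Bpos by (simp add: delta pb_def)
    show "(1 - \<tau> / (4 * n\<^sup>2)) * pb
        + real B * (Lmax * (2 + \<alpha> * Lmax) * 1 + Lmax * \<alpha> * pb + Lmax * (\<alpha> * Lmax) * pc) \<le> lam ^ B * pb"
      using gain_b by (simp only: delta left_diff_distrib)
    have "(lam - \<rho>) * pc = \<alpha> * Lmax" using rho_less by (simp add: pc_def)
    then show "\<rho> * pc + \<alpha> * Lmax * 1 \<le> lam * pc" by (simp add: left_diff_distrib)
  qed (use alpha_pos Lmax_pos rho_nonneg in \<open>simp_all add: a_def b_def c_def\<close>)
  then obtain M where M: "\<And>k. a k \<le> M * 1 * lam ^ k" "\<And>k. c k \<le> M * pc * lam ^ k" by blast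
  have "norm (x k - (\<chi> i. xstar)) \<le> (M + M * pc) * lam ^ k" for k
    using dist[of k] M[of k] by (simp add: S_def stack_rows_def distrib_right)
  then show ?thesis by blast
qed

end
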